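(* Let $k$ be $\mathbb{R}$ or $\mathbb{C}$, let $s\in[0,1]$, and let $q\in k$, $q\neq0$, be such that the Dirac $q$-monopole connection one-form $\omega$ on the quantum Hopf fibration $SU_q(2)(S^2_{qs})^{C_s}$ given in the context is defined. Let $E_s$ be the line bundle over $S^2_{qs}$, let $e_s$ be its projector and $\Theta_s:(S^2_{qs})^2e_s\to E_s$ the isomorphism given in the context. Then the covariant derivative $\nabla:E_s\to\Omega^1S^2_{qs}\otimes_{S^2_{qs}}E_s$ induced by $\omega$ is the Grassmannian connection of $e_s$. That is, when $\nabla$ is viewed via $\Theta_s$ as a map $(S^2_{qs})^2e_s\to\Omega^1S^2_{qs}\otimes_{S^2_{qs}}(S^2_{qs})^2e_s$, it is given by $$\nabla((x,y)e_s)=\big(d(x,y)+(x,y)\,de_s\big)e_s\qquad\text{for all }x,y\in S^2_{qs},$$ where $d(x,y)=(dx,dy)$ and $de_s$ is the matrix obtained by applying $d$ to each entry of $e_s$.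
   Context: $P=SU_q(2)$ is the unital associative $k$-algebra generated by $\alpha,\beta,\gamma,\delta$ subject to the relations $$\alpha\beta=q\beta\alpha,\quad \alpha\gamma=q\gamma\alpha,\quad \beta\gamma=\gamma\beta,\quad \beta\delta=q\delta\beta,\quad \gamma\delta=q\delta\gamma,$$ $$\alpha\delta=\delta\alpha+(q-q^{-1})\beta\gamma,\quad \alpha\delta-q\beta\gamma=1.$$ It is a Hopf algebra: writing $t=\begin{pmatrix}\alpha&\beta\\ \gamma&\delta\end{pmatrix}$, the coproduct is $\Delta(t_{ik})=\sum_{j=1}^2 t_{ij}\otimes t_{jk}$, the counit is $\epsilon(t_{ik})=\delta_{ik}$, and the antipode is $S(\alpha)=\delta$, $S(\beta)=-q^{-1}\beta$, $S(\gamma)=-q\gamma$, $S(\delta)=\alpha$. Sweedler notation $\Delta(c)=c_{(1)}\otimes c_{(2)}$ is used, and right coactions are written $\Delta_P(p)=p_{(0)}\otimes p_{(1)}$. The quantum two-sphere $B=S^2_{qs}$ is the subalgebra of $SU_q(2)$ generated by $1$ and $$\xi=s(\alpha^2-q^{-1}\beta^2)+(s^2-1)q^{-1}\alpha\beta,\qquad \eta=s(q\gamma^2-\delta^2)+(s^2-1)\gamma\delta,$$ $$\zeta=s(q\alpha\gamma-\beta\delta)+(s^2-1)q\beta\gamma.$$ Let $J_s=\{\xi-s,\ \eta+s,\ \zeta\}\,SU_q(2)$ (right ideal), $C_s=SU_q(2)/J_s$ the quotient coalgebra, and $\pi_s:SU_q(2)\to C_s$ the projection. $C_s$ coacts on $SU_q(2)$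 from the right by $\Delta_P=(\mathrm{id}\otimes\pi_s)\circ\Delta$. This makes $SU_q(2)$ a coalgebra principal bundle (coalgebra-Galois extension) over $S^2_{qs}$, denoted $SU_q(2)(S^2_{qs})^{C_s}$. The coalgebra $C_s$ is spanned by the group-like elements $\pi_s(1)$ and $$g_n^+=\pi_s\Big(\prod_{m=0}^{n-1}(\alpha+q^m s\beta)\Big),\qquad g_n^-=\pi_s\Big(\prod_{m=0}^{n-1}(\delta-q^{-m}s\gamma)\Big),\qquad n=1,2,\dots$$ (all products increase from left to right). For an algebra $A$, $\Omega^1A=\{\sum_i a_i\otimes a_i'\in A\otimes A : \sum_i a_ia_i'=0\}$ is the bimodule of universal one-forms, with universal differential $d(a)=1\otimes a-a\otimes 1$. The Dirac $q$-monopole connection is the linear map $\omega:C_s\to\Omega^1P$ with $\omega(\pi_s(1))=0$ and $$\omega(g_n^\pm)=S\big(i(g_n^\pm)_{(1)}\big)\,d\big(i(g_n^\pm)_{(2)}\big),$$ where $$i(g_n^+)=\prod_{m=0}^{n-1}\frac{\alpha+q^ms(\beta+\gamma)+q^{2m}s^2\delta}{1+q^{2m}s^2},\qquad i(g_n^-)=\prod_{m=0}^{n-1}\frac{\delta-q^{-m}s(\beta+\gamma)+q^{-2m}s^2\alpha}{1+q^{-2m}s^2}.$$ It is known that $\omega$ is a strong connection, i.e. a connection one-form such that $dp-p_{(0)}\omega(p_{(1)})\in(\Omega^1B)P$ for all $p\in P$. For the coalgebra principal bundle $P=SU_q(2)$ over $B=S^2_{qs}$ with structure coalgebra $C=C_s$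 and right coaction $\Delta_P=(\mathrm{id}\otimes\pi_s)\circ\Delta$, and a left $C$-comodule $V$ with coaction ${}_V\Delta$, the associated module is $E=\{\sum_i p^i\otimes v^i\in P\otimes V : \sum_i\Delta_P(p^i)\otimes v^i=\sum_i p^i\otimes{}_V\Delta(v^i)\}$. A strong connection $\omega$ induces on $E$ the covariant derivative $\nabla:E\to\Omega^1B\otimes_BE$, $$\nabla\Big(\sum_i p^i\otimes v^i\Big)=\sum_i dp^i\otimes v^i-\sum_i p^i_{(0)}\omega(p^i_{(1)})\otimes v^i,$$ where $\Omega^1B\otimes_BE$ is regarded as contained in $\Omega^1P\otimes V$ via multiplication, $\rho\otimes\sum_i p^i\otimes v^i\mapsto\sum_i\rho p^i\otimes v^i$. The line bundle $E_s$ is the left $S^2_{qs}$-module associated to $SU_q(2)$ and the one-dimensional left $C_s$-comodule $V=k$ with coaction $1\mapsto g_1^+\otimes1$. Identifying $P\otimes k$ with $P$, it is explicitly $$E_s=\{x(\alpha+s\beta)+y(\gamma+s\delta) : x,y\in S^2_{qs}\},$$ and the induced covariant derivative reads $\nabla(u)=du-u\,\omega(g_1^+)$ for $u\in E_s$. The projector of $E_s$ is the idempotent matrix $$e_s=\frac{1}{1+s^2}\begin{pmatrix}1-\zeta & \xi\\ -\eta & s^2+q^{-2}\zeta\end{pmatrix}$$ with entries in $S^2_{qs}$. Writing $(S^2_{qs})^2e_s=\{(x,y)e_s : x,y\in S^2_{qs}\}$, the map $\Theta_s:(S^2_{qs})^2e_s\to E_s$, $(x,y)e_s\mapsto x(\alpha+s\beta)+y(\gamma+s\delta)$,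 is an isomorphism of left $S^2_{qs}$-modules. Viewing $\nabla$ via $\Theta_s$ means replacing it by $(\mathrm{id}\otimes\Theta_s^{-1})\circ\nabla\circ\Theta_s$. The module $\Omega^1S^2_{qs}\otimes_{S^2_{qs}}(S^2_{qs})^2e_s$ is identified with $(\Omega^1S^2_{qs})^2e_s$, the row vectors $(\rho_1,\rho_2)e_s$ with $\rho_1,\rho_2\in\Omega^1S^2_{qs}$. *)

theory Defs
  imports
    Complex_Main
    "HOL-Library.Poly_Mapping"
    "HOL-Library.Product_Plus"
    "HOL-Algebra.QuotRing"
    "HOL-Algebra.Generated_Rings"
    "HOL-Algebra.Algebraic_Closure_Type"
begin

section \<open>Free algebras\<close>

text \<open>
  Words in the generators form a monoid, written additively so that finitely supported functions
  on words (\<^theory>\<open>HOL-Library.Poly_Mapping\<close>) carry the convolution product: this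
  is the free algebra on the generators. Functions on pairs of words are then its tensor square,
  with product determined by (u, v) * (u', v') = (u u', v v').

  Definitions are given over an arbitrary field. The case of a real or complex ground field is
  that of the type class \<^class>\<open>real_normed_field\<close>: its norm is multiplicative, so by the
  Gelfand-Mazur theorem the reals and the complex numbers are its only instances up to isomorphism.
\<close>

datatype gen = Alpha | Beta | Gamma | Delta

instantiation list :: (type) monoid_add
begin

definition zero_list :: "'a list" where "zero_list = []"

definition plus_list :: "'a list \<Rightarrow> 'a list \<Rightarrow> 'a list" where "plus_list = append"

instance by standard (simp_all add: zero_list_def plus_list_def)

end

type_synonym 'k fa = "gen list \<Rightarrow>\<^sub>0 'k"
type_synonym 'k fa2 = "(gen list \<times> gen list) \<Rightarrow>\<^sub>0 'k"

definition sc :: "'k::zero \<Rightarrow> ('m::zero \<Rightarrow>\<^sub>0 'k)" where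
  "sc c = Poly_Mapping.single 0 c"

abbreviation \<alpha> :: "'k::field fa" where "\<alpha> \<equiv> Poly_Mapping.single [Alpha] 1"
abbreviation \<beta> :: "'k::field fa" where "\<beta> \<equiv> Poly_Mapping.single [Beta] 1"
abbreviation \<gamma> :: "'k::field fa" where "\<gamma> \<equiv> Poly_Mapping.single [Gamma] 1"
abbreviation \<delta> :: "'k::field fa" where "\<delta> \<equiv> Poly_Mapping.single [Delta] 1"

definition fa_tensor :: "'k::field fa \<Rightarrow> 'k fa \<Rightarrow> 'k fa2" where
  "fa_tensor f g = (\<Sum>u\<in>Poly_Mapping.keys f. \<Sum>v\<in>Poly_Mapping.keys g.
     Poly_Mapping.single (u, v) (Poly_Mapping.lookup f u * Poly_Mapping.lookup g v))"

fun gen_coprod :: "gen \<Rightarrow> 'k::field fa2" where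
  "gen_coprod Alpha = fa_tensor \<alpha> \<alpha> + fa_tensor \<beta> \<gamma>"
| "gen_coprod Beta  = fa_tensor \<alpha> \<beta> + fa_tensor \<beta> \<delta>"
| "gen_coprod Gamma = fa_tensor \<gamma> \<alpha> + fa_tensor \<delta> \<gamma>"
| "gen_coprod Delta = fa_tensor \<gamma> \<beta> + fa_tensor \<delta> \<delta>"

definition fa_coprod :: "'k::field fa \<Rightarrow> 'k fa2" where
  "fa_coprod f = (\<Sum>w\<in>Poly_Mapping.keys f.
     sc (Poly_Mapping.lookup f w) * prod_list (map gen_coprod w))"

fun gen_antipode :: "'k::field \<Rightarrow> gen \<Rightarrow> 'k fa" where
  "gen_antipode q Alpha = \<delta>"
| "gen_antipode q Beta  = - (sc (inverse q) * \<beta>)"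
| "gen_antipode q Gamma = - (sc q * \<gamma>)"
| "gen_antipode q Delta = \<alpha>"

definition fa_antipode :: "'k::field \<Rightarrow> 'k fa \<Rightarrow> 'k fa" where
  "fa_antipode q f = (\<Sum>w\<in>Poly_Mapping.keys f.
     sc (Poly_Mapping.lookup f w) * prod_list (map (gen_antipode q) (rev w)))"


section \<open>The Hopf algebra and its tensor square\<close>

definition relators :: "'k::field \<Rightarrow> 'k fa set" where
  "relators q =
    {\<alpha> * \<beta> - sc q * \<beta> * \<alpha>, \<alpha> * \<gamma> - sc q * \<gamma> * \<alpha>, \<beta> * \<gamma> - \<gamma> * \<beta>,
     \<beta> * \<delta> - sc q * \<delta> * \<beta>, \<gamma> * \<delta> - sc q * \<delta> * \<gamma>,
     \<alpha> * \<delta> - (\<delta> * \<alpha> + sc (q - inverse q) * \<beta> * \<gamma>),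
     \<alpha> * \<delta> - sc q * \<beta> * \<gamma> - 1}"

definition rel_ideal :: "'k::field \<Rightarrow> 'k fa set" where
  "rel_ideal q = Idl\<^bsub>ring_of_type_algebra\<^esub> (relators q)"

definition SUq2 :: "'k::field \<Rightarrow> ('k fa set) ring" where
  "SUq2 q = ring_of_type_algebra Quot (rel_ideal q)"

definition pr :: "'k::field \<Rightarrow> 'k fa \<Rightarrow> 'k fa set" where
  "pr q f = rel_ideal q +>\<^bsub>ring_of_type_algebra\<^esub> f"

text \<open>P \<open>\<otimes>\<close> P for P = F/I, in the form (F \<open>\<otimes>\<close> F) / (I \<open>\<otimes>\<close> F + F \<open>\<otimes>\<close> I).\<close>

definition rel_ideal2 :: "'k::field \<Rightarrow> 'k fa2 set" where
  "rel_ideal2 q = Idl\<^bsub>ring_of_type_algebra\<^esub>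
     ((\<lambda>r. fa_tensor r 1) ` rel_ideal q \<union> (\<lambda>r. fa_tensor 1 r) ` rel_ideal q)"

definition PP :: "'k::field \<Rightarrow> ('k fa2 set) ring" where
  "PP q = ring_of_type_algebra Quot (rel_ideal2 q)"

definition pr2 :: "'k::field \<Rightarrow> 'k fa2 \<Rightarrow> 'k fa2 set" where
  "pr2 q T = rel_ideal2 q +>\<^bsub>ring_of_type_algebra\<^esub> T"

text \<open>
  Maps induced on cosets are written as unions over all representatives, as in
  \<^const>\<open>rcoset_mult\<close>.
\<close>

definition tensor :: "'k::field \<Rightarrow> 'k fa set \<Rightarrow> 'k fa set \<Rightarrow> 'k fa2 set" where
  "tensor q A B = (\<Union>x\<in>A. \<Union>y\<in>B. pr2 q (fa_tensor x y))"

definition coprod :: "'k::field \<Rightarrow> 'k fa set \<Rightarrow> 'k fa2 set" where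
  "coprod q A = (\<Union>x\<in>A. pr2 q (fa_coprod x))"

definition antipode :: "'k::field \<Rightarrow> 'k fa set \<Rightarrow> 'k fa set" where
  "antipode q A = (\<Union>x\<in>A. pr q (fa_antipode q x))"

definition lact :: "'k::field \<Rightarrow> 'k fa set \<Rightarrow> 'k fa2 set \<Rightarrow> 'k fa2 set" where
  "lact q p \<rho> = tensor q p \<one>\<^bsub>SUq2 q\<^esub> \<otimes>\<^bsub>PP q\<^esub> \<rho>"

definition ract :: "'k::field \<Rightarrow> 'k fa2 set \<Rightarrow> 'k fa set \<Rightarrow> 'k fa2 set" where
  "ract q \<rho> p = \<rho> \<otimes>\<^bsub>PP q\<^esub> tensor q \<one>\<^bsub>SUq2 q\<^esub> p"

text \<open>
  The Sweedler sum of \<open>b (p\<^sub>(\<^sub>1\<^sub>), p\<^sub>(\<^sub>2\<^sub>))\<close> in P \<open>\<otimes>\<close> P, for a bilinear map \<open>b\<close>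
  (for which the value does not depend on the chosen expansion of the coproduct).
\<close>

definition sweedler ::
  "'k::field \<Rightarrow> ('k fa set \<Rightarrow> 'k fa set \<Rightarrow> 'k fa2 set) \<Rightarrow> 'k fa set \<Rightarrow> 'k fa2 set" where
  "sweedler q b p = (THE z. \<exists>(n::nat) x y.
      x \<in> {..<n} \<rightarrow> carrier (SUq2 q) \<and> y \<in> {..<n} \<rightarrow> carrier (SUq2 q) \<and>
      coprod q p = (\<Oplus>\<^bsub>PP q\<^esub>i\<in>{..<n}. tensor q (x i) (y i)) \<and>
      z = (\<Oplus>\<^bsub>PP q\<^esub>i\<in>{..<n}. b (x i) (y i)))"


section \<open>Universal one-forms\<close>

text \<open>
  For a subalgebra A of P, the space A \<open>\<otimes>\<close> A and hence the universal one-forms of A are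
  taken inside P \<open>\<otimes>\<close> P, into which they embed because the ground ring is a field.
\<close>

definition Omega1 :: "'k::field \<Rightarrow> 'k fa set set \<Rightarrow> 'k fa2 set set" where
  "Omega1 q A = {\<Oplus>\<^bsub>PP q\<^esub>i\<in>{..<n}. tensor q (a i) (a' i) | (n::nat) a a'.
      a \<in> {..<n} \<rightarrow> A \<and> a' \<in> {..<n} \<rightarrow> A \<and>
      (\<Oplus>\<^bsub>SUq2 q\<^esub>i\<in>{..<n}. a i \<otimes>\<^bsub>SUq2 q\<^esub> a' i) = \<zero>\<^bsub>SUq2 q\<^esub>}"

definition univ_d :: "'k::field \<Rightarrow> 'k fa set \<Rightarrow> 'k fa2 set" where
  "univ_d q a = tensor q \<one>\<^bsub>SUq2 q\<^esub> a \<ominus>\<^bsub>PP q\<^esub> tensor q a \<one>\<^bsub>SUq2 q\<^esub>"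


section \<open>The quantum two-sphere and the quantum Hopf fibration\<close>

definition \<xi> :: "'k::field \<Rightarrow> 'k \<Rightarrow> 'k fa" where
  "\<xi> s q = sc s * (\<alpha>^2 - sc (inverse q) * \<beta>^2) + sc ((s^2 - 1) * inverse q) * \<alpha> * \<beta>"

definition \<eta> :: "'k::field \<Rightarrow> 'k \<Rightarrow> 'k fa" where
  "\<eta> s q = sc s * (sc q * \<gamma>^2 - \<delta>^2) + sc (s^2 - 1) * \<gamma> * \<delta>"

definition \<zeta> :: "'k::field \<Rightarrow> 'k \<Rightarrow> 'k fa" where
  "\<zeta> s q = sc s * (sc q * \<alpha> * \<gamma> - \<beta> * \<delta>) + sc ((s^2 - 1) * q) * \<beta> * \<gamma>"

definition S2 :: "'k::field \<Rightarrow> 'k \<Rightarrow> 'k fa set set" where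
  "S2 s q = generate_ring (SUq2 q) (pr q ` (range sc \<union> {\<xi> s q, \<eta> s q, \<zeta> s q}))"

definition Js :: "'k::field \<Rightarrow> 'k \<Rightarrow> 'k fa set set" where
  "Js s q = {pr q (\<xi> s q - sc s) \<otimes>\<^bsub>SUq2 q\<^esub> x \<oplus>\<^bsub>SUq2 q\<^esub> pr q (\<eta> s q + sc s) \<otimes>\<^bsub>SUq2 q\<^esub> y
              \<oplus>\<^bsub>SUq2 q\<^esub> pr q (\<zeta> s q) \<otimes>\<^bsub>SUq2 q\<^esub> z
            | x y z. x \<in> carrier (SUq2 q) \<and> y \<in> carrier (SUq2 q) \<and> z \<in> carrier (SUq2 q)}"

definition Cs :: "'k::field \<Rightarrow> 'k \<Rightarrow> 'k fa set set set" where
  "Cs s q = a_rcosets\<^bsub>SUq2 q\<^esub> (Js s q)"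

definition \<pi> :: "'k::field \<Rightarrow> 'k \<Rightarrow> 'k fa set \<Rightarrow> 'k fa set set" where
  "\<pi> s q p = Js s q +>\<^bsub>SUq2 q\<^esub> p"

definition gplus :: "'k::field \<Rightarrow> 'k \<Rightarrow> nat \<Rightarrow> 'k fa set set" where
  "gplus s q n = \<pi> s q (pr q (prod_list (map (\<lambda>m. \<alpha> + sc (q^m * s) * \<beta>) [0..<n])))"

definition gminus :: "'k::field \<Rightarrow> 'k \<Rightarrow> nat \<Rightarrow> 'k fa set set" where
  "gminus s q n = \<pi> s q (pr q (prod_list (map (\<lambda>m. \<delta> - sc (inverse q^m * s) * \<gamma>) [0..<n])))"

text \<open>
  P \<open>\<otimes>\<close> C is realised as the quotient of P \<open>\<otimes>\<close> P by P \<open>\<otimes>\<close> J, and the coaction as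
  the coproduct followed by the quotient map.
\<close>

definition PJ :: "'k::field \<Rightarrow> 'k \<Rightarrow> 'k fa2 set set" where
  "PJ s q = {\<Oplus>\<^bsub>PP q\<^esub>i\<in>{..<n}. tensor q (x i) (y i) | (n::nat) x y.
      x \<in> {..<n} \<rightarrow> carrier (SUq2 q) \<and> y \<in> {..<n} \<rightarrow> Js s q}"

definition tensorC :: "'k::field \<Rightarrow> 'k \<Rightarrow> 'k fa set \<Rightarrow> 'k fa set set \<Rightarrow> 'k fa2 set set" where
  "tensorC s q p c = (\<Union>y\<in>c. PJ s q +>\<^bsub>PP q\<^esub> tensor q p y)"

definition coaction :: "'k::field \<Rightarrow> 'k \<Rightarrow> 'k fa set \<Rightarrow> 'k fa2 set set" where
  "coaction s q p = PJ s q +>\<^bsub>PP q\<^esub> coprod q p"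

definition lactC :: "'k::field \<Rightarrow> 'k \<Rightarrow> 'k fa set \<Rightarrow> 'k fa2 set set \<Rightarrow> 'k fa2 set set" where
  "lactC s q b Z = (\<Union>z\<in>Z. PJ s q +>\<^bsub>PP q\<^esub> lact q b z)"

text \<open>
  The coinvariants in the sense of coalgebra-Galois extensions: the elements b with
  \<open>\<Delta>\<^sub>P(b p) = b \<Delta>\<^sub>P(p)\<close> for all p.
\<close>

definition coinvariants :: "'k::field \<Rightarrow> 'k \<Rightarrow> 'k fa set set" where
  "coinvariants s q = {b \<in> carrier (SUq2 q). \<forall>p\<in>carrier (SUq2 q).
      coaction s q (b \<otimes>\<^bsub>SUq2 q\<^esub> p) = lactC s q b (coaction s q p)}"


section \<open>The Dirac q-monopole\<close>

definition iplus :: "'k::field \<Rightarrow> 'k \<Rightarrow> nat \<Rightarrow> 'k fa set" where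
  "iplus s q n = pr q (prod_list (map (\<lambda>m. sc (inverse (1 + q^(2*m) * s^2)) *
      (\<alpha> + sc (q^m * s) * (\<beta> + \<gamma>) + sc (q^(2*m) * s^2) * \<delta>)) [0..<n]))"

definition iminus :: "'k::field \<Rightarrow> 'k \<Rightarrow> nat \<Rightarrow> 'k fa set" where
  "iminus s q n = pr q (prod_list (map (\<lambda>m. sc (inverse (1 + inverse q^(2*m) * s^2)) *
      (\<delta> - sc (inverse q^m * s) * (\<beta> + \<gamma>) + sc (inverse q^(2*m) * s^2) * \<alpha>)) [0..<n]))"

text \<open>
  The first two conditions say that no denominator in \<^const>\<open>iplus\<close> and \<^const>\<open>iminus\<close>
  vanishes. Linearity on C is expressed through the quotient map \<^const>\<open>\<pi>\<close>, whose linearity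
  defines the vector space structure of C.
\<close>

definition dirac_monopole ::
  "'k::field \<Rightarrow> 'k \<Rightarrow> ('k fa set set \<Rightarrow> 'k fa2 set) \<Rightarrow> bool" where
  "dirac_monopole s q \<omega> \<longleftrightarrow>
     (\<forall>m::nat. 1 + q^(2*m) * s^2 \<noteq> 0) \<and> (\<forall>m::nat. 1 + inverse q^(2*m) * s^2 \<noteq> 0) \<and>
     \<omega> \<in> Cs s q \<rightarrow> Omega1 q (carrier (SUq2 q)) \<and>
     (\<forall>x\<in>carrier (SUq2 q). \<forall>y\<in>carrier (SUq2 q).
        \<omega> (\<pi> s q (x \<oplus>\<^bsub>SUq2 q\<^esub> y)) = \<omega> (\<pi> s q x) \<oplus>\<^bsub>PP q\<^esub> \<omega> (\<pi> s q y)) \<and>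
     (\<forall>c. \<forall>x\<in>carrier (SUq2 q).
        \<omega> (\<pi> s q (pr q (sc c) \<otimes>\<^bsub>SUq2 q\<^esub> x)) = pr2 q (sc c) \<otimes>\<^bsub>PP q\<^esub> \<omega> (\<pi> s q x)) \<and>
     \<omega> (\<pi> s q \<one>\<^bsub>SUq2 q\<^esub>) = \<zero>\<^bsub>PP q\<^esub> \<and>
     (\<forall>n\<ge>1. \<omega> (gplus s q n)
        = sweedler q (\<lambda>a b. lact q (antipode q a) (univ_d q b)) (iplus s q n)) \<and>
     (\<forall>n\<ge>1. \<omega> (gminus s q n)
        = sweedler q (\<lambda>a b. lact q (antipode q a) (univ_d q b)) (iminus s q n))"

text \<open>The element \<open>dp - p\<^sub>(\<^sub>0\<^sub>) \<omega>(p\<^sub>(\<^sub>1\<^sub>))\<close>, with \<open>p\<^sub>(\<^sub>0\<^sub>) \<otimes> p\<^sub>(\<^sub>1\<^sub>)\<close> the coaction of \<open>p\<close>.\<close>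

definition nabla ::
  "'k::field \<Rightarrow> 'k \<Rightarrow> ('k fa set set \<Rightarrow> 'k fa2 set) \<Rightarrow> 'k fa set \<Rightarrow> 'k fa2 set" where
  "nabla s q \<omega> p = univ_d q p \<ominus>\<^bsub>PP q\<^esub> sweedler q (\<lambda>a b. lact q a (\<omega> (\<pi> s q b))) p"


section \<open>The line bundle and its projector\<close>

text \<open>
  The module associated to the one-dimensional left comodule with coaction 1 \<open>\<mapsto>\<close> g \<open>\<otimes>\<close> 1,
  as a subset of P = P \<open>\<otimes>\<close> k.
\<close>

definition associated_module :: "'k::field \<Rightarrow> 'k \<Rightarrow> 'k fa set set \<Rightarrow> 'k fa set set" where
  "associated_module s q g = {p \<in> carrier (SUq2 q). coaction s q p = tensorC s q p g}"

definition line_comb :: "'k::field \<Rightarrow> 'k \<Rightarrow> 'k fa set \<times> 'k fa set \<Rightarrow> 'k fa set" where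
  "line_comb s q = (\<lambda>(x, y). x \<otimes>\<^bsub>SUq2 q\<^esub> pr q (\<alpha> + sc s * \<beta>)
      \<oplus>\<^bsub>SUq2 q\<^esub> y \<otimes>\<^bsub>SUq2 q\<^esub> pr q (\<gamma> + sc s * \<delta>))"

definition line_bundle :: "'k::field \<Rightarrow> 'k \<Rightarrow> 'k fa set set" where
  "line_bundle s q = {line_comb s q (x, y) | x y. x \<in> S2 s q \<and> y \<in> S2 s q}"

text \<open>Row vectors of length two are pairs; two-by-two matrices are pairs of rows.\<close>

definition row_mult :: "'a ring \<Rightarrow> 'a \<times> 'a \<Rightarrow> ('a \<times> 'a) \<times> ('a \<times> 'a) \<Rightarrow> 'a \<times> 'a" where
  "row_mult R = (\<lambda>(x, y) ((a, b), (c, d)).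
      (x \<otimes>\<^bsub>R\<^esub> a \<oplus>\<^bsub>R\<^esub> y \<otimes>\<^bsub>R\<^esub> c, x \<otimes>\<^bsub>R\<^esub> b \<oplus>\<^bsub>R\<^esub> y \<otimes>\<^bsub>R\<^esub> d))"

definition row_add :: "'a ring \<Rightarrow> 'a \<times> 'a \<Rightarrow> 'a \<times> 'a \<Rightarrow> 'a \<times> 'a" where
  "row_add R = (\<lambda>(x, y) (x', y'). (x \<oplus>\<^bsub>R\<^esub> x', y \<oplus>\<^bsub>R\<^esub> y'))"

abbreviation row_map :: "('a \<Rightarrow> 'b) \<Rightarrow> 'a \<times> 'a \<Rightarrow> 'b \<times> 'b" where
  "row_map f \<equiv> map_prod f f"

abbreviation mat_map :: "('a \<Rightarrow> 'b) \<Rightarrow> ('a \<times> 'a) \<times> ('a \<times> 'a) \<Rightarrow> ('b \<times> 'b) \<times> ('b \<times> 'b)" where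
  "mat_map f \<equiv> map_prod (map_prod f f) (map_prod f f)"

definition projector ::
  "'k::field \<Rightarrow> 'k \<Rightarrow> ('k fa set \<times> 'k fa set) \<times> ('k fa set \<times> 'k fa set)" where
  "projector s q = mat_map (\<lambda>f. pr q (sc (inverse (1 + s^2)) * f))
     ((1 - \<zeta> s q, \<xi> s q),
      (- \<eta> s q, sc (s^2) + sc (inverse q ^ 2) * \<zeta> s q))"

definition proj_module :: "'k::field \<Rightarrow> 'k \<Rightarrow> ('k fa set \<times> 'k fa set) set" where
  "proj_module s q = {row_mult (SUq2 q) (x, y) (projector s q) | x y. x \<in> S2 s q \<and> y \<in> S2 s q}"

definition Theta :: "'k::field \<Rightarrow> 'k \<Rightarrow> 'k fa set \<times> 'k fa set \<Rightarrow> 'k fa set" where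
  "Theta s q v = (THE u. \<exists>x\<in>S2 s q. \<exists>y\<in>S2 s q.
      v = row_mult (SUq2 q) (x, y) (projector s q) \<and> u = line_comb s q (x, y))"

text \<open>
  Functions and scalars act on one-forms through the bimodule structure: multiplying a row of
  one-forms on the right by a matrix over P is multiplication in P \<open>\<otimes>\<close> P by the matrix of the
  1 \<open>\<otimes>\<close> a, and multiplying a row over P by a matrix of one-forms is multiplication in
  P \<open>\<otimes>\<close> P of the row of the a \<open>\<otimes>\<close> 1 by that matrix.
\<close>

definition form_row_mult :: "'k::field \<Rightarrow> 'k fa2 set \<times> 'k fa2 set \<Rightarrow>
    ('k fa set \<times> 'k fa set) \<times> ('k fa set \<times> 'k fa set) \<Rightarrow> 'k fa2 set \<times> 'k fa2 set" where
  "form_row_mult q \<rho> m = row_mult (PP q) \<rho> (mat_map (tensor q \<one>\<^bsub>SUq2 q\<^esub>) m)"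

definition row_form_mult :: "'k::field \<Rightarrow> 'k fa set \<times> 'k fa set \<Rightarrow>
    ('k fa2 set \<times> 'k fa2 set) \<times> ('k fa2 set \<times> 'k fa2 set) \<Rightarrow> 'k fa2 set \<times> 'k fa2 set" where
  "row_form_mult q v m = row_mult (PP q) (row_map (\<lambda>a. tensor q a \<one>\<^bsub>SUq2 q\<^esub>) v) m"

definition form_proj_module :: "'k::field \<Rightarrow> 'k \<Rightarrow> ('k fa2 set \<times> 'k fa2 set) set" where
  "form_proj_module s q = {form_row_mult q (\<rho>1, \<rho>2) (projector s q) | \<rho>1 \<rho>2.
      \<rho>1 \<in> Omega1 q (S2 s q) \<and> \<rho>2 \<in> Omega1 q (S2 s q)}"

text \<open>\<open>\<Omega>\<^sup>1B \<otimes>\<^sub>B E\<close>, regarded as contained in the one-forms of P via multiplication.\<close>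

definition form_line_bundle :: "'k::field \<Rightarrow> 'k \<Rightarrow> 'k fa2 set set" where
  "form_line_bundle s q = {\<Oplus>\<^bsub>PP q\<^esub>i\<in>{..<n}. ract q (\<rho> i) (u i) | (n::nat) \<rho> u.
      \<rho> \<in> {..<n} \<rightarrow> Omega1 q (S2 s q) \<and> u \<in> {..<n} \<rightarrow> line_bundle s q}"

text \<open>
  The map \<open>id \<otimes> \<Theta>\<close>. Under the identification of its domain with a balanced tensor product,
  the row \<open>(\<rho>1, \<rho>2) e\<close> is \<open>\<rho>1 \<otimes> (1, 0) e + \<rho>2 \<otimes> (0, 1) e\<close>.
\<close>

definition id_Theta :: "'k::field \<Rightarrow> 'k \<Rightarrow> 'k fa2 set \<times> 'k fa2 set \<Rightarrow> 'k fa2 set" where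
  "id_Theta s q v = (THE z. \<exists>\<rho>1\<in>Omega1 q (S2 s q). \<exists>\<rho>2\<in>Omega1 q (S2 s q).
      v = form_row_mult q (\<rho>1, \<rho>2) (projector s q) \<and>
      z = ract q \<rho>1 (Theta s q (row_mult (SUq2 q) (\<one>\<^bsub>SUq2 q\<^esub>, \<zero>\<^bsub>SUq2 q\<^esub>) (projector s q)))
        \<oplus>\<^bsub>PP q\<^esub>
          ract q \<rho>2 (Theta s q (row_mult (SUq2 q) (\<zero>\<^bsub>SUq2 q\<^esub>, \<one>\<^bsub>SUq2 q\<^esub>) (projector s q))))"

definition nabla_viewed :: "'k::field \<Rightarrow> 'k \<Rightarrow> ('k fa set set \<Rightarrow> 'k fa2 set)
    \<Rightarrow> 'k fa set \<times> 'k fa set \<Rightarrow> 'k fa2 set \<times> 'k fa2 set" where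
  "nabla_viewed s q \<omega> =
     inv_into (form_proj_module s q) (id_Theta s q) \<circ> nabla s q \<omega> \<circ> Theta s q"

end

theory Submission
  imports Defs
begin

text \<open>
  The projector has rank one over P. With the column u = (\<open>\<alpha> + s\<beta>, \<gamma> + s\<delta>\<close>) and the row
  v = (\<open>\<delta> - sq\<gamma>, s\<alpha> - q\<^sup>-\<^sup>1\<beta>\<close>), the relations of P give u v = \<open>(1 + s\<^sup>2) e\<close> and
  v u = \<open>1 + s\<^sup>2\<close> (\<open>uv_products\<close>, \<open>vu_product\<close>). So right multiplication by u and by
  \<open>v / (1 + s\<^sup>2)\<close> are mutually inverse: they identify rows of the form (x, y) e with the
  elements x \<open>u\<^sub>1\<close> + y \<open>u\<^sub>2\<close>, over functions and over one-forms alike. This is the map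
  \<open>\<Theta>\<close> (\<open>Theta_bij\<close>, \<open>id_Theta_bij\<close>).

  The coproduct of \<open>u\<^sub>k\<close> lies in P \<open>\<otimes>\<close> span(\<open>u\<^sub>1\<close>, \<open>u\<^sub>2\<close>) and similarly for v, so the
  coproduct of an entry of u v has its second legs among these entries. Modulo J every entry of
  u v is a scalar, its counit; hence \<open>\<Delta>(b) \<equiv> b \<otimes> 1\<close> modulo P \<open>\<otimes>\<close> J for b in the sphere,
  and \<open>\<Delta>(p) \<equiv> p \<otimes> u\<^sub>1\<close> for p in the line bundle (\<open>coprod_S2_rep\<close>, \<open>coprod_line\<close>).
  Conversely p = \<open>\<Sum>\<^sub>k (p v\<^sub>k / (1 + s\<^sup>2)) u\<^sub>k\<close>, where \<open>p v\<^sub>k\<close> is coinvariant whenever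
  \<open>\<Delta>(p) \<equiv> p \<otimes> u\<^sub>1\<close> (\<open>coinvariant_multiple\<close>).

  The element \<open>i(g\<^sub>1\<^sup>+)\<close> is \<open>(u\<^sub>1 + s u\<^sub>2) / (1 + s\<^sup>2)\<close>, and the antipodes of the first legs of
  its coproduct are the entries of v. Therefore
  \<open>\<omega>(g\<^sub>1\<^sup>+) = \<Sum>\<^sub>k v\<^sub>k \<otimes> u\<^sub>k / (1 + s\<^sup>2) - 1 \<otimes> 1\<close> (\<open>\<omega>_g1\<close>), and the covariant derivative of p
  is \<open>1 \<otimes> p - \<Sum>\<^sub>k p v\<^sub>k \<otimes> u\<^sub>k / (1 + s\<^sup>2)\<close> (\<open>nabla_line\<close>). Multiplying the Grassmannian row
  (d(x, y) + (x, y) de) e by u and using e u = u gives the same element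
  (\<open>nabla_grassmann\<close>).

  All of this is computed on representatives in the free algebra and its tensor square. An
  identity in P is then the membership of an explicit element in the ideal of relations, and the
  work in the first half is to make every construction on cosets computable in this way.
\<close>

section \<open>Linear extension from a basis\<close>

lemma sc_0 [simp]: "sc 0 = 0"
  and sc_1 [simp]: "sc 1 = 1"
  and sc_add: "sc (a + b) = sc a + sc b"
  and sc_diff: "sc (a' - b') = sc a' - sc b'"
  by (simp_all add: sc_def single_add single_diff)

lemma sc_mult: "sc (a * b) = sc a * (sc b :: 'm::monoid_add \<Rightarrow>\<^sub>0 'k::comm_ring_1)"
  by (simp add: sc_def mult_single)

lemma sc_times_single: "sc a * Poly_Mapping.single w b = 
    Poly_Mapping.single (w::'m::monoid_add) (a * b :: 'k::comm_ring_1)"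
  by (simp add: sc_def mult_single)

lemma poly_mapping_additive_induct [case_names single add]:
  assumes "\<And>w c. P (Poly_Mapping.single w c)" "\<And>f g. P f \<Longrightarrow> P g \<Longrightarrow> P (f + g)"
  shows "P (f :: 'm \<Rightarrow>\<^sub>0 'k::comm_monoid_add)"
proof (induction f rule: update_induct)
  case const
  show ?case using assms(1)[of _ 0] by simp
next
  case (update f a b)
  have "Poly_Mapping.update a b f = Poly_Mapping.single a b + f"
    using update(1) by (intro poly_mapping_eqI)
      (auto simp: lookup_update lookup_add lookup_single when_def in_keys_iff)
  then show ?case using assms update by metis
qed

lemma sc_central: "f * sc c = sc c * (f :: 'm::monoid_add \<Rightarrow>\<^sub>0 'k::comm_ring_1)"
  by (induction f rule: poly_mapping_additive_induct)
    (simp_all add: sc_def mult_single mult.commute distrib_left distrib_right)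

lemma sc_left_commute: "f * (sc c * g) = sc c * (f * g :: 'm::monoid_add \<Rightarrow>\<^sub>0 'k::comm_ring_1)"
  by (metis mult.assoc sc_central)

text \<open>
  The linear extension of a map given on words, or on pairs of words. Tensors, coproduct and
  antipode are all instances, and so are bilinear maps out of the tensor square.
\<close>

definition lin :: "('w \<Rightarrow> ('m \<Rightarrow>\<^sub>0 'k)) \<Rightarrow> ('w \<Rightarrow>\<^sub>0 'k::comm_ring_1) \<Rightarrow> ('m::monoid_add \<Rightarrow>\<^sub>0 'k)" where
  "lin \<phi> f = (\<Sum>w\<in>Poly_Mapping.keys f. sc (Poly_Mapping.lookup f w) * \<phi> w)"

lemma lin_single: "lin \<phi> (Poly_Mapping.single w c) = sc c * \<phi> w"
  by (simp add: lin_def)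

lemma lin_add: "lin \<phi> (f + g) = lin \<phi> f + lin \<phi> g"
  unfolding lin_def by (rule setsum_keys_plus_distrib) (simp_all add: sc_add distrib_right)

lemma lin_0 [simp]: "lin \<phi> 0 = 0" by (simp add: lin_def)

lemma lin_minus: "lin \<phi> (- f) = - lin \<phi> f"
  using lin_add[of \<phi> f "-f"] by (simp add: eq_neg_iff_add_eq_0 add.commute)

lemma lin_diff: "lin \<phi> (f - g) = lin \<phi> f - lin \<phi> g"
  using lin_add[of \<phi> f "-g"] by (simp add: lin_minus)

lemma lin_sum: "lin \<phi> (\<Sum>i\<in>A. f i) = (\<Sum>i\<in>A. lin \<phi> (f i))"
  by (induction A rule: infinite_finite_induct) (simp_all add: lin_add)

lemma lin_scale: "lin \<phi> (sc c * f) = sc c * lin \<phi> f"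
  by (induction f rule: poly_mapping_additive_induct)
    (simp_all add: lin_add distrib_left sc_times_single lin_single sc_mult mult.assoc)

lemma lin_add_fun: "lin (\<lambda>w. \<phi> w + \<psi> w) f = lin \<phi> f + lin \<psi> f"
  by (simp add: lin_def sum.distrib distrib_left)

lemma lin_times: "lin (\<lambda>w. x * \<phi> w) f = x * lin \<phi> f"
  by (simp add: lin_def sum_distrib_left sc_left_commute[of x])

lemma lin_mult:
  assumes "\<And>u v. \<phi> (u + v) = \<phi> u * \<phi> v"
  shows "lin \<phi> (f * g) = lin \<phi> f * lin \<phi> g"
proof (induction f rule: poly_mapping_additive_induct)
  case (single u c)
  show ?case
  proof (induction g rule: poly_mapping_additive_induct)
    case (single v d)
    show ?case
      by (simp add: lin_single mult_single sc_mult assms mult.assoc sc_left_commute[of "\<phi> u"])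
  qed (simp add: lin_add distrib_left)
qed (simp add: lin_add distrib_right)

lemma lin_antimult:
  assumes "\<And>u v. \<phi> (u + v) = \<phi> v * \<phi> u"
  shows "lin \<phi> (f * g) = lin \<phi> g * lin \<phi> f"
proof (induction f rule: poly_mapping_additive_induct)
  case (single u c)
  show ?case
  proof (induction g rule: poly_mapping_additive_induct)
    case (single v d)
    have "lin \<phi> (Poly_Mapping.single u c * Poly_Mapping.single v d) = sc (d * c) * (\<phi> v * \<phi> u)"
      by (simp add: lin_single mult_single assms mult.commute)
    then show ?case
      by (simp add: lin_single sc_mult mult.assoc sc_left_commute[of "\<phi> v"])
  qed (simp add: lin_add distrib_left distrib_right)
qed (simp add: lin_add distrib_left distrib_right)

section \<open>The tensor square of the free algebra\<close>

lemma single_tensor: "fa_tensor (Poly_Mapping.single u a) (Poly_Mapping.single v b) =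
   Poly_Mapping.single (u, v) (a * b)"
  by (simp add: fa_tensor_def)

lemma fa_tensor_lin: "fa_tensor f g = lin (\<lambda>u. lin (\<lambda>v. Poly_Mapping.single (u, v) 1) g) f"
  by (simp add: fa_tensor_def lin_def sum_distrib_left mult.assoc[symmetric] sc_mult[symmetric]
      sc_times_single)

lemma fa_tensor_add_left: "fa_tensor (f + f') g = fa_tensor f g + fa_tensor f' g"
  and fa_tensor_add_right: "fa_tensor f (g + g') = fa_tensor f g + fa_tensor f g'"
  and fa_tensor_scale_left: "fa_tensor (sc c * f) g = sc c * fa_tensor f g"
  and fa_tensor_scale_right: "fa_tensor f (sc c * g) = sc c * fa_tensor f g"
  by (simp_all add: fa_tensor_lin lin_add lin_add_fun lin_scale lin_times)

lemma fa_tensor_mult: "fa_tensor f g * fa_tensor f' g' = fa_tensor (f * f') (g * g')"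
proof (induction f rule: poly_mapping_additive_induct)
  case f: (single u c)
  show ?case
  proof (induction g rule: poly_mapping_additive_induct)
    case g: (single v d)
    show ?case
    proof (induction f' rule: poly_mapping_additive_induct)
      case f': (single u' c')
      show ?case
        by (induction g' rule: poly_mapping_additive_induct)
          (simp_all add: mult_single single_tensor fa_tensor_add_right distrib_left mult_ac)
    qed (simp add: fa_tensor_add_left distrib_left)
  qed (simp add: fa_tensor_add_right distrib_right)
qed (simp add: fa_tensor_add_left distrib_right)

abbreviation \<iota>1 :: "'k::field fa \<Rightarrow> 'k fa2" where "\<iota>1 f \<equiv> fa_tensor f 1"
abbreviation \<iota>2 :: "'k::field fa \<Rightarrow> 'k fa2" where "\<iota>2 f \<equiv> fa_tensor 1 f"

text \<open>
  The two commuting embeddings \<open>\<iota>1\<close> and \<open>\<iota>2\<close> carry the bimodule structure: \<open>\<iota>1 f\<close> acts on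
  one-forms from the left and \<open>\<iota>2 f\<close> from the right. Expanding tensors through them turns
  equations between tensors into word problems in a noncommutative ring.
\<close>

lemma fa_tensor_eq: "fa_tensor f g = \<iota>1 f * \<iota>2 g"
  by (simp add: fa_tensor_mult)

lemma fa_tensor_one [simp]: "fa_tensor 1 1 = 1"
  by (metis single_one single_tensor mult_1 zero_prod_def)

lemma fa_tensor_0 [simp]: "fa_tensor 0 g = 0" "fa_tensor f 0 = 0"
  by (simp_all add: fa_tensor_def)

lemma fa_tensor_minus_left: "fa_tensor (- f) g = - fa_tensor f g"
  and fa_tensor_minus_right: "fa_tensor f (- g) = - fa_tensor f g"
  using fa_tensor_add_left[of f "-f" g] fa_tensor_add_right[of f g "-g"]
  by (simp_all add: eq_neg_iff_add_eq_0 add.commute)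

lemma fa_tensor_diff_left: "fa_tensor (f - f') g = fa_tensor f g - fa_tensor f' g"
  and fa_tensor_diff_right: "fa_tensor f (g - g') = fa_tensor f g - fa_tensor f g'"
  using fa_tensor_add_left[of f "-f'" g] fa_tensor_add_right[of f g "-g'"]
  by (simp_all add: fa_tensor_minus_left fa_tensor_minus_right)

lemmas fa_tensor_linear = fa_tensor_add_left fa_tensor_add_right fa_tensor_minus_left
  fa_tensor_minus_right fa_tensor_diff_left fa_tensor_diff_right fa_tensor_scale_left
  fa_tensor_scale_right

lemma \<iota>1_mult: "\<iota>1 (f * g) = \<iota>1 f * \<iota>1 g"
  and \<iota>2_mult: "\<iota>2 (f * g) = \<iota>2 f * \<iota>2 g"
  and \<iota>_commute: "\<iota>2 f * \<iota>1 g = \<iota>1 g * \<iota>2 f"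
  by (simp_all add: fa_tensor_mult)

lemma \<iota>1_sc [simp]: "\<iota>1 (sc c) = sc c" and \<iota>2_sc [simp]: "\<iota>2 (sc c) = sc c"
  using fa_tensor_scale_left[of c 1 1] fa_tensor_scale_right[of 1 c 1] by simp_all

lemma fa2_induct [case_names tensor add]:
  assumes "\<And>f g. P (fa_tensor f g)" "\<And>f g. P f \<Longrightarrow> P g \<Longrightarrow> P (f + g)"
  shows "P (T :: 'k::field fa2)"
proof (induction T rule: poly_mapping_additive_induct)
  case (single w c)
  then show ?case
    using assms(1)[of "Poly_Mapping.single (fst w) c" "Poly_Mapping.single (snd w) 1"]
    by (simp add: single_tensor)
qed (rule assms(2))

section \<open>Coproduct and antipode on the free algebra\<close>

lemma fa_coprod_lin: "fa_coprod = lin (\<lambda>w. prod_list (map gen_coprod w))"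
  by (simp add: fun_eq_iff fa_coprod_def lin_def)

lemma fa_coprod_mult: "fa_coprod (f * g) = fa_coprod f * fa_coprod g"
  unfolding fa_coprod_lin by (rule lin_mult) (simp add: plus_list_def)

lemma fa_coprod_add: "fa_coprod (f + g) = fa_coprod f + fa_coprod g"
  and fa_coprod_minus: "fa_coprod (- f) = - fa_coprod f"
  and fa_coprod_diff: "fa_coprod (f - g) = fa_coprod f - fa_coprod g"
  by (simp_all add: fa_coprod_lin lin_add lin_minus lin_diff)

lemma fa_coprod_sc [simp]: "fa_coprod (sc c) = sc c"
  by (simp add: fa_coprod_lin sc_def[of c] lin_single zero_list_def)

lemma fa_coprod_1 [simp]: "fa_coprod 1 = 1"
  using fa_coprod_sc[of 1] by simp

lemma fa_coprod_gen: "fa_coprod (Poly_Mapping.single [x] 1) = gen_coprod x"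
  by (simp add: fa_coprod_lin lin_single)

lemma fa_antipode_lin: "fa_antipode q = lin (\<lambda>w. prod_list (map (gen_antipode q) (rev w)))"
  by (simp add: fun_eq_iff fa_antipode_def lin_def)

lemma fa_antipode_mult: "fa_antipode q (f * g) = fa_antipode q g * fa_antipode q f"
  unfolding fa_antipode_lin by (rule lin_antimult) (simp add: plus_list_def)

lemma fa_antipode_add: "fa_antipode q (f + g) = fa_antipode q f + fa_antipode q g"
  and fa_antipode_diff: "fa_antipode q (f - g) = fa_antipode q f - fa_antipode q g"
  by (simp_all add: fa_antipode_lin lin_add lin_diff)

lemma fa_antipode_sc [simp]: "fa_antipode q (sc c) = sc c"
  by (simp add: fa_antipode_lin sc_def[of c] lin_single zero_list_def)

lemma fa_antipode_1 [simp]: "fa_antipode q 1 = 1"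
  using fa_antipode_sc[of q 1] by simp

lemma fa_antipode_gen: "fa_antipode q (Poly_Mapping.single [x] 1) = gen_antipode q x"
  by (simp add: fa_antipode_lin lin_single)

section \<open>Quotients of a ring by a two-sided ideal\<close>

lemma type_ring: "ring (ring_of_type_algebra :: 'a::ring_1 ring)"
proof -
  have "\<exists>y. x + y = 0 \<and> y + x = 0" for x :: 'a
    by (rule exI[of _ "- x"]) simp
  then show ?thesis
    unfolding ring_of_type_algebra_def
    by unfold_locales (auto simp: algebra_simps Units_def)
qed

abbreviation TR :: "'a::ring_1 ring" where "TR \<equiv> ring_of_type_algebra"

lemma TR_simps: "carrier TR = UNIV" "x \<otimes>\<^bsub>TR\<^esub> y = x * y" "x \<oplus>\<^bsub>TR\<^esub> y = x + y" "\<zero>\<^bsub>TR\<^esub> = 0" "\<one>\<^bsub>TR\<^esub> = 1"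
  by (simp_all add: ring_of_type_algebra_def)

lemma TR_minus: "\<ominus>\<^bsub>TR\<^esub> x = - x"
proof -
  interpret ring "TR :: 'a ring" by (rule type_ring)
  show ?thesis using minus_equality[of "-x" x] by (simp add: TR_simps)
qed

lemma a_minus_eqI: 
  assumes "ring R" "x \<in> carrier R" "y \<in> carrier R" "x \<oplus>\<^bsub>R\<^esub> y = \<zero>\<^bsub>R\<^esub>"
  shows "\<ominus>\<^bsub>R\<^esub> x = y"
proof -
  interpret ring R by fact
  show ?thesis using assms by (metis a_comm minus_equality)
qed

text \<open>
  Cosets enter only through \<open>cls_eq_iff\<close>: an equation between classes is the membership of a
  difference in the ideal, where the simplifier for rings in type classes applies.
\<close>

locale type_ideal =
  fixes I :: "'r::ring_1 set"
  assumes is_ideal: "ideal I ring_of_type_algebra"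
begin

abbreviation cls :: "'r \<Rightarrow> 'r set" where "cls f \<equiv> I +>\<^bsub>ring_of_type_algebra\<^esub> f"
abbreviation Q :: "'r set ring" where "Q \<equiv> ring_of_type_algebra Quot I"

lemma I_zero: "0 \<in> I"
  and I_add: "f \<in> I \<Longrightarrow> g \<in> I \<Longrightarrow> f + g \<in> I"
  and I_minus: "f \<in> I \<Longrightarrow> - f \<in> I"
  and I_left: "f \<in> I \<Longrightarrow> a * f \<in> I"
  and I_right: "f \<in> I \<Longrightarrow> f * a \<in> I"
proof -
  interpret ideal I "TR :: 'r ring" by (rule is_ideal)
  show "0 \<in> I" using additive_subgroup.zero_closed[OF additive_subgroup_axioms] by (simp add: TR_simps)
  show "f \<in> I \<Longrightarrow> g \<in> I \<Longrightarrow> f + g \<in> I" using additive_subgroup.a_closed[OF additive_subgroup_axioms] by (simp add: TR_simps)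
  show "f \<in> I \<Longrightarrow> a * f \<in> I" using I_l_closed[of f a] by (simp add: TR_simps)
  show "f \<in> I \<Longrightarrow> f * a \<in> I" using I_r_closed[of f a] by (simp add: TR_simps)
  show "f \<in> I \<Longrightarrow> - f \<in> I" using I_l_closed[of f "- 1"] by (simp add: TR_simps)
qed

lemma I_diff: "f \<in> I \<Longrightarrow> g \<in> I \<Longrightarrow> f - g \<in> I"
  using I_add[of f "- g"] I_minus by simp

lemma cls_def': "cls f = {g. g - f \<in> I}"
proof (intro equalityI subsetI)
  fix g assume "g \<in> {g. g - f \<in> I}"
  then have "g - f \<in> I" "g = (g - f) + f" by simp_all
  then show "g \<in> cls f" unfolding a_r_coset_def r_coset_def
    by (auto simp: TR_simps intro!: bexI[of _ "g - f"])
qed (auto simp: a_r_coset_def r_coset_def TR_simps)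

lemma cls_eq_iff: "cls f = cls g \<longleftrightarrow> f - g \<in> I"
proof
  assume "cls f = cls g"
  moreover have "f \<in> cls f" by (simp add: cls_def' I_zero)
  ultimately show "f - g \<in> I" by (simp add: cls_def')
next
  assume "f - g \<in> I"
  then have "h - f \<in> I \<longleftrightarrow> h - g \<in> I" for h
    using I_add[of "h - f" "f - g"] I_diff[of "h - g" "f - g"] by auto
  then show "cls f = cls g" by (simp add: cls_def')
qed

lemma cls_self: "f \<in> cls f" by (simp add: cls_def' I_zero)

lemma ring_Q: "ring Q" by (rule ideal.quotient_is_ring[OF is_ideal])

lemma carrier_Q: "carrier Q = range cls"
  by (auto simp: FactRing_def A_RCOSETS_def RCOSETS_def a_r_coset_def ring_of_type_algebra_def)

lemma cls_mult: "cls f \<otimes>\<^bsub>Q\<^esub> cls g = cls (f * g)"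
  using ideal.rcoset_mult_add[OF is_ideal, of f g] by (simp add: FactRing_def TR_simps)

lemma cls_add: "cls f \<oplus>\<^bsub>Q\<^esub> cls g = cls (f + g)"
proof -
  interpret ideal I "TR :: 'r ring" by (rule is_ideal)
  show ?thesis using a_rcos_sum[of f g] by (simp add: FactRing_def TR_simps)
qed

lemma cls_one: "\<one>\<^bsub>Q\<^esub> = cls 1" by (simp add: FactRing_def TR_simps)

lemma cls_zero: "\<zero>\<^bsub>Q\<^esub> = cls 0"
  by (simp add: FactRing_def cls_def')

lemma cls_uminus: "\<ominus>\<^bsub>Q\<^esub> cls f = cls (- f)"
  by (rule a_minus_eqI[OF ring_Q]) (simp_all add: carrier_Q cls_add cls_zero)

lemma cls_minus: "cls f \<ominus>\<^bsub>Q\<^esub> cls g = cls (f - g)"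
  by (simp add: a_minus_def cls_uminus cls_add)

lemma cls_finsum: "finite A \<Longrightarrow> (\<Oplus>\<^bsub>Q\<^esub>i\<in>A. cls (f i)) = cls (\<Sum>i\<in>A. f i)"
proof (induction A rule: finite_induct)
  case empty
  interpret ring Q by (rule ring_Q)
  show ?case by (simp add: cls_zero)
next
  case (insert x F)
  interpret ring Q by (rule ring_Q)
  show ?case using insert by (subst finsum_insert) (auto simp: cls_add carrier_Q)
qed

text \<open>
  The coalgebra C = P/J and the space P \<open>\<otimes>\<close> C are quotients by additive subgroups that are not
  two-sided ideals, so their elements are sets of cosets. Passing to the preimage of the subgroup
  in the ring makes these second-level cosets accessible by representatives too.
\<close>

lemma coset_subgroup:
  assumes "H \<subseteq> carrier Q"
  shows "H +>\<^bsub>Q\<^esub> cls f = cls ` {g. cls (g - f) \<in> H}"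
proof (intro equalityI subsetI)
  fix x assume "x \<in> H +>\<^bsub>Q\<^esub> cls f"
  then obtain h where "h \<in> H" "x = h \<oplus>\<^bsub>Q\<^esub> cls f"
    by (auto simp: a_r_coset_def r_coset_def)
  moreover then obtain h' where "h = cls h'" using assms carrier_Q by auto
  ultimately show "x \<in> cls ` {g. cls (g - f) \<in> H}"
    by (auto simp: cls_add intro!: image_eqI[of _ _ "h' + f"])
next
  fix x assume "x \<in> cls ` {g. cls (g - f) \<in> H}"
  then obtain g where "x = cls g" "cls (g - f) \<in> H" by auto
  moreover have "cls g = cls (g - f) \<oplus>\<^bsub>Q\<^esub> cls f" by (simp add: cls_add)
  ultimately show "x \<in> H +>\<^bsub>Q\<^esub> cls f" by (auto simp: a_r_coset_def r_coset_def)
qed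

lemma coset_subgroup_eq_iff:
  assumes "H \<subseteq> carrier Q" "cls 0 \<in> H"
    and "\<And>f g. cls f \<in> H \<Longrightarrow> cls g \<in> H \<Longrightarrow> cls (f + g) \<in> H"
    and "\<And>f. cls f \<in> H \<Longrightarrow> cls (- f) \<in> H"
  shows "H +>\<^bsub>Q\<^esub> cls f = H +>\<^bsub>Q\<^esub> cls g \<longleftrightarrow> cls (f - g) \<in> H"
proof
  assume "H +>\<^bsub>Q\<^esub> cls f = H +>\<^bsub>Q\<^esub> cls g"
  moreover have "cls f \<in> H +>\<^bsub>Q\<^esub> cls f" using assms(2) by (auto simp: coset_subgroup[OF assms(1)])
  ultimately obtain h where h: "cls f = cls h" "cls (h - g) \<in> H"
    by (auto simp: coset_subgroup[OF assms(1)])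
  then have "cls (f - g) = cls (h - g)" by (simp add: cls_eq_iff)
  then show "cls (f - g) \<in> H" using h by simp
next
  assume fg: "cls (f - g) \<in> H"
  have "cls (h - f) \<in> H \<longleftrightarrow> cls (h - g) \<in> H" for h
    using assms(3)[of "h - f" "f - g"] assms(3)[of "h - g" "- (f - g)"] assms(4)[of "f - g"] fg
    by auto
  then show "H +>\<^bsub>Q\<^esub> cls f = H +>\<^bsub>Q\<^esub> cls g" by (simp add: coset_subgroup[OF assms(1)])
qed

end

lemma type_ideal_generated: "type_ideal (Idl\<^bsub>ring_of_type_algebra\<^esub> (G :: 'r::ring_1 set))"
proof (rule type_ideal.intro)
  interpret ring "TR :: 'r ring" by (rule type_ring)
  show "ideal (Idl\<^bsub>TR\<^esub> G) TR" by (rule genideal_ideal) (simp add: TR_simps)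
qed

lemma generated_incl: "g \<in> G \<Longrightarrow> g \<in> Idl\<^bsub>ring_of_type_algebra\<^esub> (G :: 'r::ring_1 set)"
proof -
  interpret ring "TR :: 'r ring" by (rule type_ring)
  show "g \<in> G \<Longrightarrow> g \<in> Idl\<^bsub>TR\<^esub> G" using genideal_self[of G] by (auto simp: TR_simps)
qed

lemma generated_induct [consumes 1, case_names generator zero add left right]:
  assumes "f \<in> Idl\<^bsub>ring_of_type_algebra\<^esub> (G :: 'r::ring_1 set)"
    and "\<And>g. g \<in> G \<Longrightarrow> P g" "P 0" "\<And>f g. P f \<Longrightarrow> P g \<Longrightarrow> P (f + g)"
    and "\<And>a f. P f \<Longrightarrow> P (a * f)" "\<And>a f. P f \<Longrightarrow> P (f * a)"
  shows "P f"
proof -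
  interpret ring "TR :: 'r ring" by (rule type_ring)
  have "P (- f)" if "P f" for f using assms(5)[of f "- 1"] that by simp
  then have "subgroup {f. P f} (add_monoid TR)"
    using assms(3,4)
    by (intro add.subgroupI) (auto simp: TR_simps TR_minus a_inv_def[symmetric])
  then have "ideal {f. P f} TR"
    by (intro idealI type_ring) (auto simp: TR_simps assms)
  then have "Idl\<^bsub>TR\<^esub> G \<subseteq> {f. P f}" using assms(2) by (intro genideal_minimal) auto
  then show ?thesis using assms(1) by auto
qed

section \<open>Representatives for the Hopf algebra and its tensor square\<close>

interpretation P: type_ideal "rel_ideal q" for q :: "'k::field"
  unfolding rel_ideal_def by (rule type_ideal_generated)

interpretation PP: type_ideal "rel_ideal2 q" for q :: "'k::field"
  unfolding rel_ideal2_def by (rule type_ideal_generated)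

lemmas pr_eq_iff = P.cls_eq_iff[folded pr_def]
  and pr_mult [simp] = P.cls_mult[folded pr_def SUq2_def]
  and pr_add [simp] = P.cls_add[folded pr_def SUq2_def]
  and pr_one [simp] = P.cls_one[folded pr_def SUq2_def]
  and pr_zero [simp] = P.cls_zero[folded pr_def SUq2_def]
  and pr_uminus [simp] = P.cls_uminus[folded pr_def SUq2_def]
  and pr_finsum = P.cls_finsum[folded pr_def SUq2_def]
  and carrier_SUq2 = P.carrier_Q[folded pr_def SUq2_def]
  and pr_self = P.cls_self[folded pr_def]
  and ring_SUq2 = P.ring_Q[folded SUq2_def]
  and pr_coset = P.coset_subgroup[folded pr_def SUq2_def]
  and pr_coset_eq_iff = P.coset_subgroup_eq_iff[folded pr_def SUq2_def]
  and mem_pr_iff = P.cls_def'[folded pr_def]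

lemmas pr2_eq_iff = PP.cls_eq_iff[folded pr2_def]
  and pr2_mult [simp] = PP.cls_mult[folded pr2_def PP_def]
  and pr2_add [simp] = PP.cls_add[folded pr2_def PP_def]
  and pr2_minus [simp] = PP.cls_minus[folded pr2_def PP_def]
  and pr2_finsum = PP.cls_finsum[folded pr2_def PP_def]
  and carrier_PP = PP.carrier_Q[folded pr2_def PP_def]
  and ring_PP = PP.ring_Q[folded PP_def]
  and pr2_coset = PP.coset_subgroup[folded pr2_def PP_def]
  and pr2_coset_eq_iff = PP.coset_subgroup_eq_iff[folded pr2_def PP_def]

lemma relators_rel_ideal: "r \<in> relators q \<Longrightarrow> r \<in> rel_ideal q"
  unfolding rel_ideal_def by (rule generated_incl)

lemma \<iota>1_rel_ideal: "f \<in> rel_ideal q \<Longrightarrow> \<iota>1 f \<in> rel_ideal2 q"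
  and \<iota>2_rel_ideal: "f \<in> rel_ideal q \<Longrightarrow> \<iota>2 f \<in> rel_ideal2 q"
  unfolding rel_ideal2_def by (auto intro!: generated_incl)

lemma fa_tensor_rel_ideal: "f \<in> rel_ideal q \<Longrightarrow> fa_tensor f g \<in> rel_ideal2 q"
  "g \<in> rel_ideal q \<Longrightarrow> fa_tensor f g \<in> rel_ideal2 q"
  by (simp_all add: fa_tensor_eq[of f g] \<iota>1_rel_ideal \<iota>2_rel_ideal PP.I_left PP.I_right)

lemma UN_const: "a \<in> A \<Longrightarrow> (\<And>x. x \<in> A \<Longrightarrow> F x = c) \<Longrightarrow> (\<Union>x\<in>A. F x) = c"
  by auto

lemma tensor_pr: "tensor q (pr q f) (pr q g) = pr2 q (fa_tensor f g)"
  unfolding tensor_def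
proof (intro UN_const)
  show "f \<in> pr q f" "g \<in> pr q g" by (rule pr_self)+
  fix x y assume "x \<in> pr q f" "y \<in> pr q g"
  then have "x - f \<in> rel_ideal q" "y - g \<in> rel_ideal q" by (simp_all add: mem_pr_iff)
  then have "fa_tensor (x - f) y + fa_tensor f (y - g) \<in> rel_ideal2 q"
    by (intro PP.I_add fa_tensor_rel_ideal)
  then show "pr2 q (fa_tensor x y) = pr2 q (fa_tensor f g)"
    by (simp add: pr2_eq_iff fa_tensor_diff_left fa_tensor_diff_right)
qed

section \<open>The defining relations under antipode and coproduct\<close>

text \<open>
  Modulo the determinant relation, the relation between \<open>\<alpha>\<delta>\<close> and \<open>\<delta>\<alpha>\<close> is equivalent to the
  second determinant relation \<open>\<delta>\<alpha> - q\<^sup>-\<^sup>1\<beta>\<gamma> = 1\<close>. The coproducts of the two determinant relations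
  have a simple shape, while the coproduct of the original relation mixes them.
\<close>

definition rel_ab :: "'k::field \<Rightarrow> 'k fa" where "rel_ab q = \<alpha> * \<beta> - sc q * \<beta> * \<alpha>"
definition rel_ac :: "'k::field \<Rightarrow> 'k fa" where "rel_ac q = \<alpha> * \<gamma> - sc q * \<gamma> * \<alpha>"
definition rel_bc :: "'k::field fa" where "rel_bc = \<beta> * \<gamma> - \<gamma> * \<beta>"
definition rel_bd :: "'k::field \<Rightarrow> 'k fa" where "rel_bd q = \<beta> * \<delta> - sc q * \<delta> * \<beta>"
definition rel_cd :: "'k::field \<Rightarrow> 'k fa" where "rel_cd q = \<gamma> * \<delta> - sc q * \<delta> * \<gamma>"
definition rel_det :: "'k::field \<Rightarrow> 'k fa" where "rel_det q = \<alpha> * \<delta> - sc q * \<beta> * \<gamma> - 1"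
definition rel_det' :: "'k::field \<Rightarrow> 'k fa" where
  "rel_det' q = \<delta> * \<alpha> - sc (inverse q) * \<beta> * \<gamma> - 1"

lemmas rel_defs = rel_ab_def rel_ac_def rel_bc_def rel_bd_def rel_cd_def rel_det_def rel_det'_def

lemma relators_eq: "relators q =
    {rel_ab q, rel_ac q, rel_bc, rel_bd q, rel_cd q, rel_det q - rel_det' q, rel_det q}"
  by (simp add: relators_def rel_defs sc_diff algebra_simps)

lemma rel_in_ideal [simp]:
  "rel_ab q \<in> rel_ideal q" "rel_ac q \<in> rel_ideal q" "rel_bc \<in> rel_ideal q"
  "rel_bd q \<in> rel_ideal q" "rel_cd q \<in> rel_ideal q" "rel_det q \<in> rel_ideal q"
  "rel_det' q \<in> rel_ideal q"
proof -
  show *: "rel_ab q \<in> rel_ideal q" "rel_ac q \<in> rel_ideal q" "rel_bc \<in> rel_ideal q"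
    "rel_bd q \<in> rel_ideal q" "rel_cd q \<in> rel_ideal q" "rel_det q \<in> rel_ideal q"
    by (simp_all add: relators_rel_ideal relators_eq)
  have "rel_det q - rel_det' q \<in> rel_ideal q"
    by (simp add: relators_rel_ideal relators_eq)
  from P.I_diff[OF *(6) this] show "rel_det' q \<in> rel_ideal q" by simp
qed

lemma gen_coprod_\<iota>:
  "gen_coprod Alpha = \<iota>1 \<alpha> * \<iota>2 \<alpha> + \<iota>1 \<beta> * \<iota>2 \<gamma>"
  "gen_coprod Beta = \<iota>1 \<alpha> * \<iota>2 \<beta> + \<iota>1 \<beta> * \<iota>2 \<delta>"
  "gen_coprod Gamma = \<iota>1 \<gamma> * \<iota>2 \<alpha> + \<iota>1 \<delta> * \<iota>2 \<gamma>"
  "gen_coprod Delta = \<iota>1 \<gamma> * \<iota>2 \<beta> + \<iota>1 \<delta> * \<iota>2 \<delta>"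
  by (simp_all only: gen_coprod.simps fa_tensor_eq[symmetric])

lemma \<iota>_left_commute: "\<iota>2 f * (\<iota>1 g * T) = \<iota>1 g * (\<iota>2 f * T)"
  by (simp only: mult.assoc[symmetric] \<iota>_commute)

lemma fa_antipode_gens [simp]:
  "fa_antipode q \<alpha> = \<delta>" "fa_antipode q \<beta> = - (sc (inverse q) * \<beta>)"
  "fa_antipode q \<gamma> = - (sc q * \<gamma>)" "fa_antipode q \<delta> = \<alpha>"
  by (simp_all add: fa_antipode_gen)

lemma fa_coprod_gens:
  "fa_coprod \<alpha> = \<iota>1 \<alpha> * \<iota>2 \<alpha> + \<iota>1 \<beta> * \<iota>2 \<gamma>"
  "fa_coprod \<beta> = \<iota>1 \<alpha> * \<iota>2 \<beta> + \<iota>1 \<beta> * \<iota>2 \<delta>"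
  "fa_coprod \<gamma> = \<iota>1 \<gamma> * \<iota>2 \<alpha> + \<iota>1 \<delta> * \<iota>2 \<gamma>"
  "fa_coprod \<delta> = \<iota>1 \<gamma> * \<iota>2 \<beta> + \<iota>1 \<delta> * \<iota>2 \<delta>"
  by (simp_all only: fa_coprod_gen gen_coprod_\<iota>)

lemma sc_sc_left: "sc a * (sc b * f) = sc (a * b) * (f :: 'm::monoid_add \<Rightarrow>\<^sub>0 'k::comm_ring_1)"
  by (simp add: sc_mult mult.assoc)

lemmas fa_norm = sc_central[of "Poly_Mapping.single w 1" for w] 
   sc_left_commute[of "Poly_Mapping.single w 1" for w] sc_mult[symmetric] sc_sc_left
lemmas fa2_norm = \<iota>1_mult \<iota>2_mult fa_tensor_linear \<iota>_commute \<iota>_left_commute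
   sc_central[of "fa_tensor f g" for f g] sc_left_commute[of "fa_tensor f g" for f g]
   sc_mult[symmetric] sc_sc_left 

text \<open>
  Certificates that antipode and coproduct preserve the relations: the image of each relation is
  written as a combination of relations. To find these, the coproduct is sorted by first or second
  legs: for example the terms of \<open>\<Delta>(\<alpha>\<beta> - q\<beta>\<alpha>)\<close> with first leg \<open>\<alpha>\<beta>\<close> have second leg
  \<open>\<alpha>\<delta> - q\<beta>\<gamma>\<close>, which is 1 up to a determinant relation.
\<close>

lemma antipode_rels:
  assumes "q \<noteq> (0::'k::field)"
  shows
  "fa_antipode q (rel_ab q) = - (sc (inverse q) * rel_bd q)"
  "fa_antipode q (rel_ac q) = - (sc q * rel_cd q)"
  "fa_antipode q rel_bc = - rel_bc"
  "fa_antipode q (rel_bd q) = - (sc (inverse q) * rel_ab q)"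
  "fa_antipode q (rel_cd q) = - (sc q * rel_ac q)"
  "fa_antipode q (rel_det q) = rel_det q + sc q * rel_bc"
  "fa_antipode q (rel_det' q) = rel_det' q + sc (inverse q) * rel_bc"
  by (simp_all add: rel_defs fa_antipode_add fa_antipode_mult fa_antipode_diff assms fa_norm algebra_simps)

lemma coprod_rels:
  assumes "q \<noteq> (0::'k::field)"
  shows
  "fa_coprod (rel_ab q) = \<iota>1 (\<alpha> * \<alpha>) * \<iota>2 (rel_ab q) + \<iota>1 (\<beta> * \<beta>) * \<iota>2 (rel_cd q) +
     \<iota>1 (\<alpha> * \<beta>) * \<iota>2 (rel_det q) - \<iota>1 (\<beta> * \<alpha>) * \<iota>2 (sc q * rel_det' q + rel_bc) + \<iota>1 (rel_ab q)"
  "fa_coprod (rel_ac q) = \<iota>1 (rel_ac q) * \<iota>2 (\<alpha> * \<alpha>) + \<iota>1 (rel_bd q) * \<iota>2 (\<gamma> * \<gamma>) +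
     \<iota>1 (rel_det q + sc q * rel_bc) * \<iota>2 (\<alpha> * \<gamma>) - \<iota>1 (sc q * rel_det' q) * \<iota>2 (\<gamma> * \<alpha>) + \<iota>2 (rel_ac q)"
  "fa_coprod (rel_bd q) = \<iota>1 (rel_ac q) * \<iota>2 (\<beta> * \<beta>) + \<iota>1 (rel_bd q) * \<iota>2 (\<delta> * \<delta>) +
     \<iota>1 (rel_det q + sc q * rel_bc) * \<iota>2 (\<beta> * \<delta>) - \<iota>1 (sc q * rel_det' q) * \<iota>2 (\<delta> * \<beta>) + \<iota>2 (rel_bd q)"
  "fa_coprod (rel_cd q) = \<iota>1 (\<gamma> * \<gamma>) * \<iota>2 (rel_ab q) + \<iota>1 (\<delta> * \<delta>) * \<iota>2 (rel_cd q) +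
     \<iota>1 (\<gamma> * \<delta>) * \<iota>2 (rel_det q) - \<iota>1 (\<delta> * \<gamma>) * \<iota>2 (sc q * rel_det' q + rel_bc) + \<iota>1 (rel_cd q)"
  "fa_coprod (rel_det q) = \<iota>1 (\<alpha> * \<gamma>) * \<iota>2 (rel_ab q) + \<iota>1 (\<beta> * \<delta>) * \<iota>2 (rel_cd q) +
     \<iota>1 (\<alpha> * \<delta>) * \<iota>2 (rel_det q) - \<iota>1 (\<beta> * \<gamma>) * \<iota>2 (sc q * rel_det' q + rel_bc) + \<iota>1 (rel_det q)"
  "fa_coprod (rel_det' q) = \<iota>1 (rel_det' q) * \<iota>2 (\<delta> * \<alpha>) - \<iota>1 (sc (inverse q) * rel_ac q) * \<iota>2 (\<beta> * \<alpha>) -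
     \<iota>1 (sc (inverse q) * rel_bd q) * \<iota>2 (\<delta> * \<gamma>) - \<iota>1 (sc (inverse q) * rel_det q + rel_bc) * \<iota>2 (\<beta> * \<gamma>) + \<iota>2 (rel_det' q)"
  "fa_coprod rel_bc = \<iota>1 (rel_ac q) * \<iota>2 (\<beta> * \<alpha>) - \<iota>1 (\<gamma> * \<alpha>) * \<iota>2 (rel_ab q) +
     \<iota>1 (rel_bd q) * \<iota>2 (\<delta> * \<gamma>) - \<iota>1 (\<delta> * \<beta>) * \<iota>2 (rel_cd q) +
     \<iota>1 (rel_det q - rel_det' q) * \<iota>2 (\<beta> * \<gamma>) - \<iota>1 (\<beta> * \<gamma>) * \<iota>2 (rel_det q - rel_det' q) +
     \<iota>1 rel_bc * \<iota>2 (\<alpha> * \<delta>) + \<iota>1 (\<delta> * \<alpha>) * \<iota>2 rel_bc"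
  by (simp_all add: rel_defs fa_coprod_add fa_coprod_mult fa_coprod_diff fa_coprod_gens assms fa2_norm algebra_simps)

lemma fa_coprod_0 [simp]: "fa_coprod 0 = 0" and fa_antipode_0 [simp]: "fa_antipode q 0 = 0"
  by (simp_all add: fa_coprod_lin fa_antipode_lin)

lemma antipode_rel_ideal:
  assumes q: "q \<noteq> (0::'k::field)" and f: "f \<in> rel_ideal q"
  shows "fa_antipode q f \<in> rel_ideal q"
  using f[unfolded rel_ideal_def]
proof (induction rule: generated_induct)
  case (generator g)
  then show ?case
    by (auto simp: relators_eq antipode_rels[OF q] fa_antipode_diff[of q "rel_det q" "rel_det' q"]
        intro!: P.I_add P.I_diff P.I_minus P.I_left)
qed (simp_all add: fa_antipode_add fa_antipode_mult P.I_zero P.I_add P.I_left P.I_right)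

lemma coprod_rel_ideal:
  assumes q: "q \<noteq> (0::'k::field)" and f: "f \<in> rel_ideal q"
  shows "fa_coprod f \<in> rel_ideal2 q"
  using f[unfolded rel_ideal_def]
proof (induction rule: generated_induct)
  case (generator g)
  have left: "\<iota>1 r * T \<in> rel_ideal2 q" if "r \<in> rel_ideal q" for r T
    using that by (intro PP.I_right \<iota>1_rel_ideal)
  have right: "T * \<iota>2 r \<in> rel_ideal2 q" if "r \<in> rel_ideal q" for r T
    using that by (intro PP.I_left \<iota>2_rel_ideal)
  note closure = PP.I_add PP.I_diff P.I_add P.I_diff P.I_left \<iota>1_rel_ideal \<iota>2_rel_ideal
  have "fa_coprod (rel_ab q) \<in> rel_ideal2 q" "fa_coprod (rel_ac q) \<in> rel_ideal2 q"
    "fa_coprod (rel_bd q) \<in> rel_ideal2 q" "fa_coprod (rel_cd q) \<in> rel_ideal2 q"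
    "fa_coprod (rel_det q) \<in> rel_ideal2 q" "fa_coprod (rel_det' q) \<in> rel_ideal2 q"
    "fa_coprod rel_bc \<in> rel_ideal2 q"
    unfolding coprod_rels[OF q]
    by (simp_all add: closure left right)
  then show ?case using generator
    by (auto simp: relators_eq fa_coprod_diff[of "rel_det q" "rel_det' q"] intro!: PP.I_diff)
qed (simp_all add: fa_coprod_add fa_coprod_mult PP.I_zero PP.I_add PP.I_left PP.I_right)

lemma coprod_pr:
  assumes q: "q \<noteq> (0::'k::field)"
  shows "coprod q (pr q f) = pr2 q (fa_coprod f)"
  unfolding coprod_def
proof (intro UN_const)
  show "f \<in> pr q f" by (rule pr_self)
  fix x assume "x \<in> pr q f"
  then have "x - f \<in> rel_ideal q" by (simp add: mem_pr_iff)
  then show "pr2 q (fa_coprod x) = pr2 q (fa_coprod f)"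
    by (simp add: pr2_eq_iff fa_coprod_diff[symmetric] coprod_rel_ideal[OF q])
qed

lemma antipode_pr:
  assumes q: "q \<noteq> (0::'k::field)"
  shows "antipode q (pr q f) = pr q (fa_antipode q f)"
  unfolding antipode_def
proof (intro UN_const)
  show "f \<in> pr q f" by (rule pr_self)
  fix x assume "x \<in> pr q f"
  then have "x - f \<in> rel_ideal q" by (simp add: mem_pr_iff)
  then show "pr q (fa_antipode q x) = pr q (fa_antipode q f)"
    by (simp add: pr_eq_iff fa_antipode_diff[symmetric] antipode_rel_ideal[OF q])
qed

lemma univ_d_pr: "univ_d q (pr q f) = pr2 q (\<iota>2 f - \<iota>1 f)"
  by (simp add: univ_d_def tensor_pr)

lemma lact_pr: "lact q (pr q f) (pr2 q T) = pr2 q (\<iota>1 f * T)"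
  by (simp add: lact_def tensor_pr)

lemma ract_pr: "ract q (pr2 q T) (pr q f) = pr2 q (T * \<iota>2 f)"
  by (simp add: ract_def tensor_pr)

section \<open>Finite sums of elements of a given shape\<close>

text \<open>
  The spans of tensors in the definitions are indexed by a number of summands and two families.
  The following set gives them closure under addition and an induction principle.
\<close>

definition sums_of :: "'a::comm_monoid_add set \<Rightarrow> 'a set" where
  "sums_of U = {sum z {..<n} | (n::nat) z. \<forall>i<n. z i \<in> U}"

lemma sums_ofI: "(\<And>i. i < n \<Longrightarrow> z i \<in> U) \<Longrightarrow> (\<Sum>i<(n::nat). z i) \<in> sums_of U"
  by (auto simp: sums_of_def)

lemma sums_of_induct [consumes 1, case_names zero add]:
  assumes "T \<in> sums_of U" "P 0" "\<And>T x. T \<in> sums_of U \<Longrightarrow> P T \<Longrightarrow> x \<in> U \<Longrightarrow> P (T + x)"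
  shows "P T"
proof -
  obtain n z where z: "\<forall>i<n. z i \<in> U" and T: "T = (\<Sum>i<(n::nat). z i)"
    using assms(1) by (auto simp: sums_of_def)
  have "P (\<Sum>i<m. z i)" if "m \<le> n" for m
    using that
  proof (induction m)
    case (Suc m)
    then have "P ((\<Sum>i<m. z i) + z m)" using z by (intro assms(3) sums_ofI) auto
    then show ?case by simp
  qed (simp add: assms(2))
  then show ?thesis by (simp add: T)
qed

lemma sums_of_zero: "0 \<in> sums_of U"
  using sums_ofI[of 0 _ U] by simp

lemma sums_of_add_one:
  assumes "T \<in> sums_of U" "x \<in> U"
  shows "T + x \<in> sums_of U"
proof -
  obtain n z where z: "\<forall>i<n. z i \<in> U" and T: "T = (\<Sum>i<(n::nat). z i)"
    using assms(1) by (auto simp: sums_of_def)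
  have "(\<Sum>i<Suc n. (z(n := x)) i) \<in> sums_of U"
    using z assms(2) by (intro sums_ofI) (auto simp: less_Suc_eq)
  moreover have "(\<Sum>i<n. (z(n := x)) i) = (\<Sum>i<n. z i)" by (intro sum.cong) auto
  ultimately show ?thesis by (simp add: T)
qed

lemma sums_of_incl: "x \<in> U \<Longrightarrow> x \<in> sums_of U"
  using sums_of_add_one[OF sums_of_zero] by fastforce

lemma sums_of_add:
  assumes "T \<in> sums_of U" "T' \<in> sums_of U"
  shows "T + T' \<in> sums_of U"
  using assms(2) 
  by (induction rule: sums_of_induct) (simp_all add: assms(1) add.assoc[symmetric] sums_of_add_one)

lemma sums_of_map:
  assumes "T \<in> sums_of U" "h 0 = 0" "\<And>a b. h (a + b) = h a + h b" "\<And>x. x \<in> U \<Longrightarrow> h x \<in> sums_of V"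
  shows "h T \<in> sums_of V"
  using assms(1) by (induction rule: sums_of_induct) (simp_all add: assms sums_of_add sums_of_zero)

lemma SUq2_reps:
  assumes "x \<in> {..<n} \<rightarrow> A" "A \<subseteq> carrier (SUq2 q)"
  obtains x' where "\<And>i. i < (n::nat) \<Longrightarrow> x i = pr q (x' i)" "\<And>i. i < n \<Longrightarrow> pr q (x' i) \<in> A"
proof -
  have "\<exists>f. x i = pr q f" if "i < n" for i
    using that assms by (auto simp: Pi_iff carrier_SUq2 image_iff subset_iff)
  then obtain x' where x': "\<And>i. i < n \<Longrightarrow> x i = pr q (x' i)" by metis
  show ?thesis
  proof (rule that[of x'])
    show "x i = pr q (x' i)" if "i < n" for i using that by (rule x')
    show "pr q (x' i) \<in> A" if "i < n" for i using assms(1) that by (simp add: x' Pi_iff)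
  qed
qed

lemma finsum_tensor_pr:
  assumes "\<And>i. i < n \<Longrightarrow> x i = pr q (x' i)" "\<And>i. i < n \<Longrightarrow> y i = pr q (y' i)"
  shows "(\<Oplus>\<^bsub>PP q\<^esub>i\<in>{..<n::nat}. tensor q (x i) (y i)) = pr2 q (\<Sum>i<n. fa_tensor (x' i) (y' i))"
proof -
  interpret ring "PP q" by (rule ring_PP)
  have "(\<Oplus>\<^bsub>PP q\<^esub>i\<in>{..<n}. tensor q (x i) (y i)) = (\<Oplus>\<^bsub>PP q\<^esub>i\<in>{..<n}. pr2 q (fa_tensor (x' i) (y' i)))"
    using assms by (intro finsum_cong') (auto simp: tensor_pr carrier_PP)
  then show ?thesis by (simp add: pr2_finsum)
qed

lemma tensor_sums_eq:
  assumes "A \<subseteq> carrier (SUq2 q)" "B \<subseteq> carrier (SUq2 q)"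
  shows "{\<Oplus>\<^bsub>PP q\<^esub>i\<in>{..<n}. tensor q (x i) (y i) | (n::nat) x y. x \<in> {..<n} \<rightarrow> A \<and> y \<in> {..<n} \<rightarrow> B}
    = pr2 q ` sums_of {fa_tensor f g | f g. pr q f \<in> A \<and> pr q g \<in> B}" (is "?L = ?R")
proof (intro equalityI subsetI)
  fix Z assume "Z \<in> ?L"
  then obtain n :: nat and x y where xy: "x \<in> {..<n} \<rightarrow> A" "y \<in> {..<n} \<rightarrow> B"
    and Z: "Z = (\<Oplus>\<^bsub>PP q\<^esub>i\<in>{..<n}. tensor q (x i) (y i))" by blast
  obtain x' where x': "\<And>i. i < n \<Longrightarrow> x i = pr q (x' i)" "\<And>i. i < n \<Longrightarrow> pr q (x' i) \<in> A"
    using SUq2_reps[OF xy(1) assms(1)] by blast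
  obtain y' where y': "\<And>i. i < n \<Longrightarrow> y i = pr q (y' i)" "\<And>i. i < n \<Longrightarrow> pr q (y' i) \<in> B"
    using SUq2_reps[OF xy(2) assms(2)] by blast
  have "Z = pr2 q (\<Sum>i<n. fa_tensor (x' i) (y' i))"
    unfolding Z using x' y' by (intro finsum_tensor_pr)
  moreover have "(\<Sum>i<n. fa_tensor (x' i) (y' i)) \<in> sums_of {fa_tensor f g | f g. pr q f \<in> A \<and> pr q g \<in> B}"
    by (rule sums_ofI) (use x'(2) y'(2) in blast)
  ultimately show "Z \<in> ?R" by blast
next
  fix Z assume "Z \<in> ?R"
  then obtain n :: nat and z where z: "\<forall>i<n. z i \<in> {fa_tensor f g | f g. pr q f \<in> A \<and> pr q g \<in> B}"
    and Z: "Z = pr2 q (\<Sum>i<n. z i)" unfolding sums_of_def by blast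
  have "\<exists>f g. z i = fa_tensor f g \<and> pr q f \<in> A \<and> pr q g \<in> B" if "i < n" for i
    using that z by blast
  then obtain x y where xy: "\<And>i. i < n \<Longrightarrow> z i = fa_tensor (x i) (y i) \<and> pr q (x i) \<in> A \<and> pr q (y i) \<in> B"
    by metis
  have "Z = (\<Oplus>\<^bsub>PP q\<^esub>i\<in>{..<n}. tensor q (pr q (x i)) (pr q (y i)))"
    unfolding Z using xy by (subst finsum_tensor_pr) auto
  moreover have "(\<lambda>i. pr q (x i)) \<in> {..<n} \<rightarrow> A" "(\<lambda>i. pr q (y i)) \<in> {..<n} \<rightarrow> B"
    using xy by auto
  ultimately show "Z \<in> ?L"
    by (intro CollectI exI[of _ n] exI[of _ "\<lambda>i. pr q (x i)"] exI[of _ "\<lambda>i. pr q (y i)"] conjI)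
qed

lemma fa2_sums: "T \<in> sums_of {fa_tensor f g | f g. True}"
  by (induction T rule: fa2_induct) (auto intro: sums_of_add sums_of_incl)

section \<open>Sweedler sums\<close>

text \<open>
  A bilinear map on the free algebra, extended to its tensor square. The value of a Sweedler sum
  is the value of such an extension on the coproduct, which shows its independence of the expansion.
\<close>

definition bil :: "('k fa \<Rightarrow> 'k fa \<Rightarrow> ('m::monoid_add \<Rightarrow>\<^sub>0 'k)) \<Rightarrow> 'k::field fa2 \<Rightarrow> ('m \<Rightarrow>\<^sub>0 'k)" where
  "bil B = lin (\<lambda>(u, v). B (Poly_Mapping.single u 1) (Poly_Mapping.single v 1))"

lemma bil_add: "bil B (S + T) = bil B S + bil B T"
  and bil_diff: "bil B (S - T) = bil B S - bil B T"
  and bil_scale: "bil B (sc c * T) = sc c * bil B T"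
  and bil_0 [simp]: "bil B 0 = 0"
  by (simp_all add: bil_def lin_add lin_diff lin_scale)

definition bilinear_fa :: "('k::field fa \<Rightarrow> 'k fa \<Rightarrow> ('m::monoid_add \<Rightarrow>\<^sub>0 'k)) \<Rightarrow> bool" where
  "bilinear_fa B \<longleftrightarrow> (\<forall>f f' g. B (f + f') g = B f g + B f' g) \<and> (\<forall>f g g'. B f (g + g') = B f g + B f g') \<and>
    (\<forall>c f g. B (sc c * f) g = sc c * B f g) \<and> (\<forall>c f g. B f (sc c * g) = sc c * B f g)"

lemma bil_tensor:
  assumes "bilinear_fa B"
  shows "bil B (fa_tensor f g) = B f g"
proof (induction f rule: poly_mapping_additive_induct)
  case f: (single u c)
  show ?case
  proof (induction g rule: poly_mapping_additive_induct)
    case g: (single v d)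
    have "B (Poly_Mapping.single u c) (Poly_Mapping.single v d) =
        B (sc c * Poly_Mapping.single u 1) (sc d * Poly_Mapping.single v 1)"
      by (simp add: sc_times_single)
    also have "\<dots> = sc (c * d) * B (Poly_Mapping.single u 1) (Poly_Mapping.single v 1)"
      using assms by (simp add: bilinear_fa_def sc_sc_left mult.commute)
    finally show ?case by (simp add: bil_def single_tensor lin_single)
  qed (use assms in \<open>simp add: bilinear_fa_def fa_tensor_add_right bil_add\<close>)
qed (use assms in \<open>simp add: bilinear_fa_def fa_tensor_add_left bil_add\<close>)

context
  fixes q :: "'k::field" and b :: "'k fa set \<Rightarrow> 'k fa set \<Rightarrow> 'k fa2 set" and B
  assumes b: "\<And>f g. b (pr q f) (pr q g) = pr2 q (B f g)" and B: "bilinear_fa B"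
begin

text \<open>
  The statement is stable under multiplication only in the stronger form that
  \<open>bil B (U * T * V)\<close> lies in the ideal for all U and V. For a generator T this reduces to tensors
  with one leg in the ideal of relations, on which a map that is well defined on cosets vanishes.
\<close>

lemma bil_rel_ideal2:
  assumes T: "T \<in> rel_ideal2 q"
  shows "bil B T \<in> rel_ideal2 q"
proof -
  have vanish: "bil B (fa_tensor f g) \<in> rel_ideal2 q" if "f \<in> rel_ideal q \<or> g \<in> rel_ideal q" for f g
  proof -
    have "pr q f = pr q 0 \<or> pr q g = pr q 0" using that by (simp add: pr_eq_iff)
    then have "pr2 q (B f g) = pr2 q (B 0 g) \<or> pr2 q (B f g) = pr2 q (B f 0)"
      unfolding b[symmetric] by auto
    moreover have "B 0 g = 0" "B f 0 = 0"
      using bil_tensor[OF B, of 0 g] bil_tensor[OF B, of f 0] by simp_all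
    ultimately show ?thesis by (auto simp: bil_tensor[OF B] pr2_eq_iff)
  qed
  have sandwich: "bil B (U * fa_tensor f g * V) \<in> rel_ideal2 q"
    if "f \<in> rel_ideal q \<or> g \<in> rel_ideal q" for f g U V
  proof (induction U rule: fa2_induct)
    case U: (tensor x x')
    show ?case
    proof (induction V rule: fa2_induct)
      case (tensor y y')
      have "x * f * y \<in> rel_ideal q \<or> x' * g * y' \<in> rel_ideal q"
        using that by (auto intro: P.I_left P.I_right)
      then show ?case by (simp add: fa_tensor_mult vanish)
    qed (simp add: distrib_left bil_add PP.I_add)
  qed (simp add: distrib_right bil_add PP.I_add)
  have "\<forall>U V. bil B (U * T * V) \<in> rel_ideal2 q"
    using T unfolding rel_ideal2_def
  proof (induction rule: generated_induct)
    case (generator T)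
    then show ?case unfolding rel_ideal2_def[symmetric] by (auto intro: sandwich)
  next
    case (add S T)
    then show ?case
      unfolding rel_ideal2_def[symmetric] by (simp add: distrib_left distrib_right bil_add PP.I_add)
  qed (auto simp: mult.assoc[symmetric], simp_all add: mult.assoc rel_ideal2_def[symmetric] PP.I_zero)
  from this[rule_format, of 1 1] show ?thesis by simp
qed

lemma sweedler_eq:
  assumes q: "q \<noteq> 0"
  shows "sweedler q b (pr q p) = pr2 q (bil B (fa_coprod p))"
  unfolding sweedler_def
proof (rule the_equality)
  let ?A = "carrier (SUq2 q)"
  interpret ring "PP q" by (rule ring_PP)
  have val: "(\<Oplus>\<^bsub>PP q\<^esub>i\<in>{..<n}. b (x i) (y i)) = pr2 q (bil B (\<Sum>i<n. fa_tensor (x' i) (y' i)))"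
    if x': "\<And>i. i < n \<Longrightarrow> x i = pr q (x' i)" and y': "\<And>i. i < n \<Longrightarrow> y i = pr q (y' i)"
    for n :: nat and x y x' y'
  proof -
    have "(\<Oplus>\<^bsub>PP q\<^esub>i\<in>{..<n}. b (x i) (y i)) = (\<Oplus>\<^bsub>PP q\<^esub>i\<in>{..<n}. pr2 q (B (x' i) (y' i)))"
    proof (rule finsum_cong')
      show "b (x i) (y i) = pr2 q (B (x' i) (y' i))" if "i \<in> {..<n}" for i
        using x'[of i] y'[of i] that by (simp add: b)
    qed (auto simp: carrier_PP)
    also have "\<dots> = pr2 q (\<Sum>i<n. bil B (fa_tensor (x' i) (y' i)))"
      by (simp add: pr2_finsum bil_tensor[OF B])
    finally show ?thesis by (simp add: bil_def lin_sum)
  qed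
  obtain n :: nat and z where "\<forall>i<n. z i \<in> {fa_tensor f g | f g. True}" "fa_coprod p = (\<Sum>i<n. z i)"
    using fa2_sums[of "fa_coprod p"] unfolding sums_of_def by blast
  moreover then obtain x y where "\<And>i. i < n \<Longrightarrow> z i = fa_tensor (x i) (y i)"
    unfolding mem_Collect_eq by metis
  ultimately have xy: "fa_coprod p = (\<Sum>i<n. fa_tensor (x i) (y i))" by simp
  show "\<exists>(n::nat) x y. x \<in> {..<n} \<rightarrow> ?A \<and> y \<in> {..<n} \<rightarrow> ?A \<and>
      coprod q (pr q p) = (\<Oplus>\<^bsub>PP q\<^esub>i\<in>{..<n}. tensor q (x i) (y i)) \<and>
      pr2 q (bil B (fa_coprod p)) = (\<Oplus>\<^bsub>PP q\<^esub>i\<in>{..<n}. b (x i) (y i))"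
  proof (intro exI conjI)
    show "(\<lambda>i. pr q (x i)) \<in> {..<n} \<rightarrow> ?A" "(\<lambda>i. pr q (y i)) \<in> {..<n} \<rightarrow> ?A"
      by (auto simp: carrier_SUq2)
    show "coprod q (pr q p) = (\<Oplus>\<^bsub>PP q\<^esub>i\<in>{..<n}. tensor q (pr q (x i)) (pr q (y i)))"
      using finsum_tensor_pr[of n "\<lambda>i. pr q (x i)" q x "\<lambda>i. pr q (y i)" y] by (simp add: coprod_pr[OF q] xy)
    show "pr2 q (bil B (fa_coprod p)) = (\<Oplus>\<^bsub>PP q\<^esub>i\<in>{..<n}. b (pr q (x i)) (pr q (y i)))"
      using val[of n "\<lambda>i. pr q (x i)" x "\<lambda>i. pr q (y i)" y] by (simp add: xy)
  qed
  fix Z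
  assume "\<exists>(n::nat) x y. x \<in> {..<n} \<rightarrow> ?A \<and> y \<in> {..<n} \<rightarrow> ?A \<and>
      coprod q (pr q p) = (\<Oplus>\<^bsub>PP q\<^esub>i\<in>{..<n}. tensor q (x i) (y i)) \<and>
      Z = (\<Oplus>\<^bsub>PP q\<^esub>i\<in>{..<n}. b (x i) (y i))"
  then obtain n :: nat and x y where xy: "x \<in> {..<n} \<rightarrow> ?A" "y \<in> {..<n} \<rightarrow> ?A"
    and cop: "coprod q (pr q p) = (\<Oplus>\<^bsub>PP q\<^esub>i\<in>{..<n}. tensor q (x i) (y i))"
    and Z: "Z = (\<Oplus>\<^bsub>PP q\<^esub>i\<in>{..<n}. b (x i) (y i))" by (elim exE conjE) (rule that)
  obtain x' where x': "\<And>i. i < n \<Longrightarrow> x i = pr q (x' i)"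
      "\<And>i. i < n \<Longrightarrow> pr q (x' i) \<in> ?A"
    by (rule SUq2_reps[OF xy(1) order_refl], rule that)
  obtain y' where y': "\<And>i. i < n \<Longrightarrow> y i = pr q (y' i)"
      "\<And>i. i < n \<Longrightarrow> pr q (y' i) \<in> ?A"
    by (rule SUq2_reps[OF xy(2) order_refl], rule that)
  have "pr2 q (fa_coprod p) = pr2 q (\<Sum>i<n. fa_tensor (x' i) (y' i))"
    using cop finsum_tensor_pr[of n x q x' y y', OF x'(1) y'(1)] by (simp add: coprod_pr[OF q])
  then have "fa_coprod p - (\<Sum>i<n. fa_tensor (x' i) (y' i)) \<in> rel_ideal2 q"
    by (simp add: pr2_eq_iff)
  from bil_rel_ideal2[OF this] have
    "pr2 q (bil B (fa_coprod p)) = pr2 q (bil B (\<Sum>i<n. fa_tensor (x' i) (y' i)))"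
    by (simp add: pr2_eq_iff bil_diff)
  then show "Z = pr2 q (bil B (fa_coprod p))"
    unfolding Z using val[of n x x' y y', OF x'(1) y'(1)] by simp
qed

end

section \<open>The rank-one factorisation of the projector\<close>

text \<open>
  The line bundle is spanned over the sphere by \<open>u\<^sub>1\<close> and \<open>u\<^sub>2\<close>; as t (1, s), the column u has
  counit (1, s). The row v is the antipode of (1, s) t and has counit (1, s) as well.
\<close>

definition u\<^sub>1 :: "'k::field \<Rightarrow> 'k fa" where "u\<^sub>1 s = \<alpha> + sc s * \<beta>"
definition u\<^sub>2 :: "'k::field \<Rightarrow> 'k fa" where "u\<^sub>2 s = \<gamma> + sc s * \<delta>"
definition v\<^sub>1 :: "'k::field \<Rightarrow> 'k \<Rightarrow> 'k fa" where "v\<^sub>1 s q = \<delta> - sc (s * q) * \<gamma>"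
definition v\<^sub>2 :: "'k::field \<Rightarrow> 'k \<Rightarrow> 'k fa" where "v\<^sub>2 s q = sc s * \<alpha> - sc (inverse q) * \<beta>"

lemmas uv_defs = u\<^sub>1_def u\<^sub>2_def v\<^sub>1_def v\<^sub>2_def

lemma inverse_cancel:
  assumes "q \<noteq> (0::'k::field)"
  shows "q * (x * inverse q) = x" "q * (x * (y * inverse q)) = x * y"
    "q * (inverse q * inverse q) = inverse q" "q * (x * (inverse q * inverse q)) = x * inverse q"
    "q * (x * (y * (inverse q * inverse q))) = x * (y * inverse q)"
  using assms by (simp_all add: field_simps)

text \<open>
  The left-hand sides are the entries of u v, the right-hand sides those of \<open>(1 + s\<^sup>2) e\<close> up to
  relations.
\<close>

lemma uv_products:
  assumes q: "q \<noteq> (0::'k::field)"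
  shows "u\<^sub>1 s * v\<^sub>1 s q = 1 - \<zeta> s q + rel_det q"
    "u\<^sub>1 s * v\<^sub>2 s q = \<xi> s q - sc (s^2 * inverse q) * rel_ab q"
    "u\<^sub>2 s * v\<^sub>1 s q = - \<eta> s q + sc (s^2) * rel_cd q"
    "u\<^sub>2 s * v\<^sub>2 s q = sc (s^2) + sc (inverse q ^ 2) * \<zeta> s q
      + (sc (s^2) * rel_det' q + sc (inverse q) * rel_bc
        - sc (s * inverse q) * rel_ac q + sc (s * inverse q ^ 2) * rel_bd q)"
  by (simp_all add: uv_defs rel_defs \<xi>_def \<eta>_def \<zeta>_def fa_norm power2_eq_square q inverse_cancel[OF q]
      algebra_simps sc_add sc_diff)

lemma vu_product:
  assumes q: "q \<noteq> (0::'k::field)"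
  shows "v\<^sub>1 s q * u\<^sub>1 s + v\<^sub>2 s q * u\<^sub>2 s = sc (1 + s^2)
     + (rel_det' q + sc s * rel_ac q - sc (s * inverse q) * rel_bd q + sc (s^2) * rel_det q + sc (s^2 * q) * rel_bc)"
  by (simp add: uv_defs rel_defs fa_norm power2_eq_square q inverse_cancel[OF q] algebra_simps sc_add sc_diff)

lemma uv_coprod:
  assumes q: "q \<noteq> (0::'k::field)"
  shows "fa_coprod (u\<^sub>1 s) = \<iota>1 \<alpha> * \<iota>2 (u\<^sub>1 s) + \<iota>1 \<beta> * \<iota>2 (u\<^sub>2 s)"
    "fa_coprod (u\<^sub>2 s) = \<iota>1 \<gamma> * \<iota>2 (u\<^sub>1 s) + \<iota>1 \<delta> * \<iota>2 (u\<^sub>2 s)"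
    "fa_coprod (v\<^sub>1 s q) = \<iota>1 \<delta> * \<iota>2 (v\<^sub>1 s q) - \<iota>1 (sc q * \<gamma>) * \<iota>2 (v\<^sub>2 s q)"
    "fa_coprod (v\<^sub>2 s q) = \<iota>1 \<alpha> * \<iota>2 (v\<^sub>2 s q) - \<iota>1 (sc (inverse q) * \<beta>) * \<iota>2 (v\<^sub>1 s q)"
  by (simp_all add: uv_defs fa_coprod_add fa_coprod_diff fa_coprod_mult fa_coprod_gens fa2_norm q inverse_cancel[OF q]
      algebra_simps)

section \<open>The coalgebra and the coaction\<close>

definition Js_rep :: "'k::field \<Rightarrow> 'k \<Rightarrow> 'k fa set" where "Js_rep s q = {f. pr q f \<in> Js s q}"
definition PJ_rep :: "'k::field \<Rightarrow> 'k \<Rightarrow> 'k fa2 set" where "PJ_rep s q = {T. pr2 q T \<in> PJ s q}"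

lemma Js_rep_iff: "f \<in> Js_rep s q \<longleftrightarrow> (\<exists>x y z. f - ((\<xi> s q - sc s) * x + (\<eta> s q + sc s) * y + \<zeta> s q * z) \<in> rel_ideal q)"
proof -
  have "Js s q = {pr q ((\<xi> s q - sc s) * x + (\<eta> s q + sc s) * y + \<zeta> s q * z) | x y z. True}"
  proof (intro equalityI subsetI)
    fix A assume "A \<in> Js s q"
    then show "A \<in> {pr q ((\<xi> s q - sc s) * x + (\<eta> s q + sc s) * y + \<zeta> s q * z) | x y z. True}"
      unfolding Js_def carrier_SUq2 by (auto; blast)
  next
    fix A assume "A \<in> {pr q ((\<xi> s q - sc s) * x + (\<eta> s q + sc s) * y + \<zeta> s q * z) | x y z. True}"
    then obtain x y z where "A = pr q ((\<xi> s q - sc s) * x + (\<eta> s q + sc s) * y + \<zeta> s q * z)"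
      by blast
    then show "A \<in> Js s q"
      unfolding Js_def carrier_SUq2 mem_Collect_eq
      by (intro exI[of _ "pr q x"] exI[of _ "pr q y"] exI[of _ "pr q z"]) simp
  qed
  then show ?thesis by (simp add: Js_rep_def pr_eq_iff)
qed

lemma Js_carrier: "Js s q \<subseteq> carrier (SUq2 q)"
  unfolding Js_def carrier_SUq2 by auto

lemma Js_rep_ideal: "f \<in> rel_ideal q \<Longrightarrow> f \<in> Js_rep s q"
  unfolding Js_rep_iff by (rule exI[of _ 0], rule exI[of _ 0], rule exI[of _ 0]) simp

lemma Js_rep_gens: "\<xi> s q - sc s \<in> Js_rep s q" "\<eta> s q + sc s \<in> Js_rep s q" "\<zeta> s q \<in> Js_rep s q"
  unfolding Js_rep_iff
  by (rule exI[of _ 1], rule exI[of _ 0], rule exI[of _ 0], simp add: P.I_zero,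
      rule exI[of _ 0], rule exI[of _ 1], rule exI[of _ 0], simp add: P.I_zero,
      rule exI[of _ 0], rule exI[of _ 0], rule exI[of _ 1], simp add: P.I_zero)

lemma Js_rep_add: 
  assumes "f \<in> Js_rep s q" "g \<in> Js_rep s q"
  shows "f + g \<in> Js_rep s q"
proof -
  let ?l = "\<lambda>x y z. (\<xi> s q - sc s) * x + (\<eta> s q + sc s) * y + \<zeta> s q * z"
  obtain x y z x' y' z' where *: "f - ?l x y z \<in> rel_ideal q" "g - ?l x' y' z' \<in> rel_ideal q"
    using assms unfolding Js_rep_iff by blast
  have "(f + g) - ?l (x + x') (y + y') (z + z') = (f - ?l x y z) + (g - ?l x' y' z')"
    by (simp add: algebra_simps)
  also have "\<dots> \<in> rel_ideal q" by (rule P.I_add[OF *])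
  finally show ?thesis unfolding Js_rep_iff by blast
qed

lemma Js_rep_right: 
  assumes "f \<in> Js_rep s q"
  shows "f * g \<in> Js_rep s q"
proof -
  let ?l = "\<lambda>x y z. (\<xi> s q - sc s) * x + (\<eta> s q + sc s) * y + \<zeta> s q * z"
  obtain x y z where *: "f - ?l x y z \<in> rel_ideal q"
    using assms unfolding Js_rep_iff by blast
  have "f * g - ?l (x * g) (y * g) (z * g) = (f - ?l x y z) * g"
    by (simp add: algebra_simps)
  also have "\<dots> \<in> rel_ideal q" by (rule P.I_right[OF *])
  finally show ?thesis unfolding Js_rep_iff by blast
qed

lemma Js_rep_scale: "f \<in> Js_rep s q \<Longrightarrow> sc c * f \<in> Js_rep s q"
  using Js_rep_right[of f s q "sc c"] by (simp add: sc_central)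

lemma Js_rep_minus: "f \<in> Js_rep s q \<Longrightarrow> - f \<in> Js_rep s q"
  using Js_rep_right[of f s q "- 1"] by simp

lemma Js_rep_diff: "f \<in> Js_rep s q \<Longrightarrow> g \<in> Js_rep s q \<Longrightarrow> f - g \<in> Js_rep s q"
  using Js_rep_add[of f s q "- g"] Js_rep_minus[of g s q] by simp

lemma PJ_sums: "PJ s q = pr2 q ` sums_of {fa_tensor f g | f g. g \<in> Js_rep s q}"
proof -
  have "{fa_tensor f g |f g. pr q f \<in> carrier (SUq2 q) \<and> pr q g \<in> Js s q} = {fa_tensor f g | f g. g \<in> Js_rep s q}"
    by (auto simp: Js_rep_def carrier_SUq2)
  then show ?thesis
    unfolding PJ_def by (subst tensor_sums_eq[OF order_refl Js_carrier]) simp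
qed

lemma PJ_carrier: "PJ s q \<subseteq> carrier (PP q)"
  unfolding PJ_sums carrier_PP by auto

lemma PJ_rep_iff: "T \<in> PJ_rep s q \<longleftrightarrow> (\<exists>S \<in> sums_of {fa_tensor f g | f g. g \<in> Js_rep s q}. T - S \<in> rel_ideal2 q)"
  unfolding PJ_rep_def PJ_sums image_iff mem_Collect_eq pr2_eq_iff by (rule refl)

lemma PJ_rep_sums: "S \<in> sums_of {fa_tensor f g | f g. g \<in> Js_rep s q} \<Longrightarrow> S \<in> PJ_rep s q"
  unfolding PJ_rep_iff by (rule bexI[of _ S]) (simp_all add: PP.I_zero)

lemma PJ_rep_tensor: "g \<in> Js_rep s q \<Longrightarrow> fa_tensor f g \<in> PJ_rep s q"
  by (intro PJ_rep_sums sums_of_incl) blast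

lemma PJ_rep_ideal: "T \<in> rel_ideal2 q \<Longrightarrow> T \<in> PJ_rep s q"
  unfolding PJ_rep_iff by (rule bexI[of _ 0]) (simp_all add: sums_of_zero)

lemma PJ_rep_add:
  assumes "S \<in> PJ_rep s q" "T \<in> PJ_rep s q"
  shows "S + T \<in> PJ_rep s q"
proof -
  obtain S' T' where *: "S' \<in> sums_of {fa_tensor f g | f g. g \<in> Js_rep s q}" "S - S' \<in> rel_ideal2 q"
    "T' \<in> sums_of {fa_tensor f g | f g. g \<in> Js_rep s q}" "T - T' \<in> rel_ideal2 q"
    using assms unfolding PJ_rep_iff by blast
  have "(S + T) - (S' + T') = (S - S') + (T - T')" by simp
  also have "\<dots> \<in> rel_ideal2 q" using * by (intro PP.I_add)
  finally show ?thesis unfolding PJ_rep_iff using sums_of_add[OF *(1,3)] by blast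
qed

text \<open>
  J is a right ideal, so P \<open>\<otimes>\<close> J absorbs arbitrary factors on the right, but on the left only
  those that act on the first leg.
\<close>

lemma PJ_rep_mult:
  assumes "T \<in> PJ_rep s q"
  shows "\<iota>1 a * T * R \<in> PJ_rep s q"
proof -
  obtain S where S: "S \<in> sums_of {fa_tensor f g | f g. g \<in> Js_rep s q}" "T - S \<in> rel_ideal2 q"
    using assms unfolding PJ_rep_iff by blast
  have "\<iota>1 a * fa_tensor f g * R \<in> sums_of {fa_tensor f g | f g. g \<in> Js_rep s q}" if "g \<in> Js_rep s q" for f g
  proof (induction R rule: fa2_induct)
    case (tensor x y)
    show ?case using Js_rep_right[OF that, of y]
      by (intro sums_of_incl) (auto simp: fa_tensor_mult)
  qed (simp add: distrib_left sums_of_add)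
  then have "\<iota>1 a * S * R \<in> sums_of {fa_tensor f g | f g. g \<in> Js_rep s q}"
    using S(1) by (rule_tac sums_of_map[where h = "\<lambda>S. \<iota>1 a * S * R"])
      (auto simp: distrib_left distrib_right)
  moreover have "\<iota>1 a * T * R - \<iota>1 a * S * R = \<iota>1 a * (T - S) * R" by (simp add: algebra_simps)
  moreover have "\<iota>1 a * (T - S) * R \<in> rel_ideal2 q" using S(2) by (intro PP.I_left PP.I_right)
  ultimately show ?thesis unfolding PJ_rep_iff by (intro bexI[of _ "\<iota>1 a * S * R"]) simp_all
qed

lemma PJ_rep_left: "T \<in> PJ_rep s q \<Longrightarrow> \<iota>1 a * T \<in> PJ_rep s q"
  using PJ_rep_mult[of T s q a 1] by simp

lemma PJ_rep_right: "T \<in> PJ_rep s q \<Longrightarrow> T * R \<in> PJ_rep s q"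
  using PJ_rep_mult[of T s q 1 R] by simp

lemma PJ_rep_minus: "T \<in> PJ_rep s q \<Longrightarrow> - T \<in> PJ_rep s q"
  using PJ_rep_right[of T s q "- 1"] by simp

lemma PJ_rep_diff: "S \<in> PJ_rep s q \<Longrightarrow> T \<in> PJ_rep s q \<Longrightarrow> S - T \<in> PJ_rep s q"
  using PJ_rep_add[of S s q "- T"] PJ_rep_minus[of T s q] by simp

lemma \<pi>_pr: "\<pi> s q (pr q f) = pr q ` {g. g - f \<in> Js_rep s q}"
  unfolding \<pi>_def by (simp add: pr_coset[OF Js_carrier] Js_rep_def)

lemma \<pi>_cong: "f - g \<in> Js_rep s q \<Longrightarrow> \<pi> s q (pr q f) = \<pi> s q (pr q g)"
  unfolding \<pi>_def using Js_rep_add Js_rep_minus Js_rep_ideal[of 0]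
  by (subst pr_coset_eq_iff[OF Js_carrier]) (auto simp: Js_rep_def P.I_zero)

lemma PJ_coset_eq_iff: "PJ s q +>\<^bsub>PP q\<^esub> pr2 q S = PJ s q +>\<^bsub>PP q\<^esub> pr2 q T \<longleftrightarrow> S - T \<in> PJ_rep s q"
  using PJ_rep_add PJ_rep_minus PJ_rep_ideal[of 0]
  by (subst pr2_coset_eq_iff[OF PJ_carrier]) (auto simp: PJ_rep_def PP.I_zero)

lemma coaction_pr: "q \<noteq> 0 \<Longrightarrow> coaction s q (pr q f) = PJ s q +>\<^bsub>PP q\<^esub> pr2 q (fa_coprod f)"
  by (simp add: coaction_def coprod_pr)

lemma tensorC_\<pi>: "tensorC s q (pr q f) (\<pi> s q (pr q g)) = PJ s q +>\<^bsub>PP q\<^esub> pr2 q (fa_tensor f g)"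
  unfolding tensorC_def
proof (rule UN_const)
  show "pr q g \<in> \<pi> s q (pr q g)" by (auto simp: \<pi>_pr Js_rep_ideal P.I_zero)
  fix y assume "y \<in> \<pi> s q (pr q g)"
  then obtain h where h: "y = pr q h" "h - g \<in> Js_rep s q" by (auto simp: \<pi>_pr)
  then show "PJ s q +>\<^bsub>PP q\<^esub> tensor q (pr q f) y = PJ s q +>\<^bsub>PP q\<^esub> pr2 q (fa_tensor f g)"
    by (simp add: tensor_pr PJ_coset_eq_iff fa_tensor_diff_right[symmetric] PJ_rep_tensor)
qed

lemma lactC_coset: "lactC s q (pr q b) (PJ s q +>\<^bsub>PP q\<^esub> pr2 q T) = PJ s q +>\<^bsub>PP q\<^esub> pr2 q (\<iota>1 b * T)"
  unfolding lactC_def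
proof (rule UN_const)
  have mem: "z \<in> PJ s q +>\<^bsub>PP q\<^esub> pr2 q T \<longleftrightarrow> (\<exists>S. z = pr2 q S \<and> S - T \<in> PJ_rep s q)" for z
    by (auto simp: pr2_coset[OF PJ_carrier] PJ_rep_def)
  show "pr2 q T \<in> PJ s q +>\<^bsub>PP q\<^esub> pr2 q T"
    unfolding mem by (intro exI[of _ T]) (simp add: PJ_rep_ideal PP.I_zero)
  fix z assume "z \<in> PJ s q +>\<^bsub>PP q\<^esub> pr2 q T"
  then obtain S where "z = pr2 q S" "S - T \<in> PJ_rep s q" unfolding mem by blast
  then show "PJ s q +>\<^bsub>PP q\<^esub> lact q (pr q b) z = PJ s q +>\<^bsub>PP q\<^esub> pr2 q (\<iota>1 b * T)"
    by (simp add: lact_pr PJ_coset_eq_iff right_diff_distrib[symmetric] PJ_rep_left)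
qed

lemma gplus_1: "gplus s q 1 = \<pi> s q (pr q (u\<^sub>1 s))"
  by (simp add: gplus_def u\<^sub>1_def)

lemma associated_module_iff:
  assumes "q \<noteq> 0"
  shows "pr q f \<in> associated_module s q (gplus s q 1) \<longleftrightarrow> fa_coprod f - fa_tensor f (u\<^sub>1 s) \<in> PJ_rep s q"
  unfolding associated_module_def gplus_1
  by (simp add: coaction_pr[OF assms] tensorC_\<pi> PJ_coset_eq_iff carrier_SUq2)

lemma coinvariants_iff:
  assumes "q \<noteq> 0"
  shows "pr q b \<in> coinvariants s q \<longleftrightarrow> (\<forall>f. fa_coprod (b * f) - \<iota>1 b * fa_coprod f \<in> PJ_rep s q)"
  unfolding coinvariants_def carrier_SUq2
  by (simp add: coaction_pr[OF assms] lactC_coset PJ_coset_eq_iff)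

section \<open>The sphere\<close>

definition S2_rep :: "'k::field \<Rightarrow> 'k \<Rightarrow> 'k fa set" where "S2_rep s q = {f. pr q f \<in> S2 s q}"

lemma S2_rep_sc [simp]: "sc c \<in> S2_rep s q" and S2_rep_gens [simp]: "\<xi> s q \<in> S2_rep s q" "\<eta> s q \<in> S2_rep s q" "\<zeta> s q \<in> S2_rep s q"
  unfolding S2_rep_def S2_def mem_Collect_eq by (rule generate_ring.incl; simp)+

lemma S2_rep_add: "f \<in> S2_rep s q \<Longrightarrow> g \<in> S2_rep s q \<Longrightarrow> f + g \<in> S2_rep s q"
  unfolding S2_rep_def S2_def mem_Collect_eq pr_add[symmetric] by (rule generate_ring.eng_add)

lemma S2_rep_mult: "f \<in> S2_rep s q \<Longrightarrow> g \<in> S2_rep s q \<Longrightarrow> f * g \<in> S2_rep s q"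
  unfolding S2_rep_def S2_def mem_Collect_eq pr_mult[symmetric] by (rule generate_ring.eng_mult)

lemma S2_rep_minus: "f \<in> S2_rep s q \<Longrightarrow> - f \<in> S2_rep s q"
  unfolding S2_rep_def S2_def mem_Collect_eq pr_uminus[symmetric] by (rule generate_ring.a_inv)

lemma S2_rep_diff: "f \<in> S2_rep s q \<Longrightarrow> g \<in> S2_rep s q \<Longrightarrow> f - g \<in> S2_rep s q"
  using S2_rep_add[of f s q "- g"] S2_rep_minus[of g s q] by simp

lemma S2_rep_0 [simp]: "0 \<in> S2_rep s q" and S2_rep_1 [simp]: "1 \<in> S2_rep s q"
  using S2_rep_sc[of 0 s q] S2_rep_sc[of 1 s q] by simp_all

lemma S2_carrier: "S2 s q \<subseteq> carrier (SUq2 q)"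
  unfolding S2_def by (rule ring.generate_ring_incl[OF ring_SUq2]) (auto simp: carrier_SUq2)

lemma S2_reps: "S2 s q = pr q ` S2_rep s q"
  using S2_carrier[of s q] by (auto simp: S2_rep_def carrier_SUq2)

text \<open>
  Up to scalars and relations these four differences are the generators of J: J is generated by
  the elements of the sphere with vanishing counit.
\<close>

lemma uv_counit:
  assumes q: "q \<noteq> (0::'k::field)"
  shows "u\<^sub>1 s * v\<^sub>1 s q - 1 \<in> Js_rep s q" "u\<^sub>1 s * v\<^sub>2 s q - sc s \<in> Js_rep s q"
    "u\<^sub>2 s * v\<^sub>1 s q - sc s \<in> Js_rep s q" "u\<^sub>2 s * v\<^sub>2 s q - sc (s^2) \<in> Js_rep s q"
proof -
  have "u\<^sub>1 s * v\<^sub>1 s q - 1 = - \<zeta> s q + rel_det q" by (simp add: uv_products[OF q])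
  also have "\<dots> \<in> Js_rep s q" by (intro Js_rep_add Js_rep_minus Js_rep_gens Js_rep_ideal rel_in_ideal)
  finally show "u\<^sub>1 s * v\<^sub>1 s q - 1 \<in> Js_rep s q" .
  have "u\<^sub>1 s * v\<^sub>2 s q - sc s = (\<xi> s q - sc s) - sc (s^2 * inverse q) * rel_ab q"
    by (simp add: uv_products[OF q])
  also have "\<dots> \<in> Js_rep s q" by (intro Js_rep_diff[OF Js_rep_gens(1)] Js_rep_scale Js_rep_ideal rel_in_ideal)
  finally show "u\<^sub>1 s * v\<^sub>2 s q - sc s \<in> Js_rep s q" .
  have "u\<^sub>2 s * v\<^sub>1 s q - sc s = - (\<eta> s q + sc s) + sc (s^2) * rel_cd q"
    by (simp add: uv_products[OF q])
  also have "\<dots> \<in> Js_rep s q" by (intro Js_rep_add[OF Js_rep_minus[OF Js_rep_gens(2)]] Js_rep_scale Js_rep_ideal rel_in_ideal)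
  finally show "u\<^sub>2 s * v\<^sub>1 s q - sc s \<in> Js_rep s q" .
  have "u\<^sub>2 s * v\<^sub>2 s q - sc (s^2) = sc (inverse q ^ 2) * \<zeta> s q
      + (sc (s^2) * rel_det' q + sc (inverse q) * rel_bc
        - sc (s * inverse q) * rel_ac q + sc (s * inverse q ^ 2) * rel_bd q)"
    by (simp add: uv_products[OF q])
  also have "\<dots> \<in> Js_rep s q"
    by (intro Js_rep_add Js_rep_diff Js_rep_scale Js_rep_gens; intro Js_rep_ideal rel_in_ideal)
  finally show "u\<^sub>2 s * v\<^sub>2 s q - sc (s^2) \<in> Js_rep s q" .
qed

text \<open>
  Here \<open>U\<close> is one of the entries of u and \<open>V\<close> one of the entries of v. Their coproducts have second
  legs in u and in v with the coefficients that also express them through the counits, so the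
  difference is a sum of tensors whose second legs are entries of u v minus their counits.
\<close>

lemma coprod_uv:
  assumes q: "q \<noteq> (0::'k::field)"
    and U: "U = a + sc s * a'" "fa_coprod U = \<iota>1 a * \<iota>2 (u\<^sub>1 s) + \<iota>1 a' * \<iota>2 (u\<^sub>2 s)"
    and V: "V = b + sc s * b'" "fa_coprod V = \<iota>1 b * \<iota>2 (v\<^sub>1 s q) + \<iota>1 b' * \<iota>2 (v\<^sub>2 s q)"
  shows "fa_coprod (U * V) - \<iota>1 (U * V) \<in> PJ_rep s q"
proof -
  have "fa_coprod (U * V) - \<iota>1 (U * V) =
    fa_tensor (a * b) (u\<^sub>1 s * v\<^sub>1 s q - 1) + fa_tensor (a * b') (u\<^sub>1 s * v\<^sub>2 s q - sc s) +
    fa_tensor (a' * b) (u\<^sub>2 s * v\<^sub>1 s q - sc s) + fa_tensor (a' * b') (u\<^sub>2 s * v\<^sub>2 s q - sc (s^2))"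
    unfolding fa_coprod_mult U(2) V(2) 
    by (simp add: U(1) V(1) fa_tensor_mult fa_tensor_diff_right distrib_left distrib_right mult.assoc
        fa_tensor_add_left fa_tensor_scale_left fa_tensor_scale_right[of _ _ 1, simplified] 
        sc_left_commute[of a] sc_left_commute[of a'] sc_sc_left power2_eq_square)
  also have "\<dots> \<in> PJ_rep s q" by (intro PJ_rep_add PJ_rep_tensor uv_counit[OF q])
  finally show ?thesis .
qed

text \<open>
  The property passes from b and b' to b b' because P \<open>\<otimes>\<close> J is stable under the multiplications
  in \<open>PJ_rep_mult\<close>, so it suffices to have it for the generators, which are entries of u v
  up to signs and constants.
\<close>

lemma coprod_S2_rep:
  assumes q: "q \<noteq> (0::'k::field)" and b: "b \<in> S2_rep s q"
  shows "fa_coprod b - \<iota>1 b \<in> PJ_rep s q"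
proof -
  define good where "good b \<longleftrightarrow> fa_coprod b - \<iota>1 b \<in> PJ_rep s q" for b
  have cong: "good f" if "good g" "f - g \<in> rel_ideal q" for f g
  proof -
    have "fa_coprod f - \<iota>1 f = (fa_coprod g - \<iota>1 g) + (fa_coprod (f - g) - \<iota>1 (f - g))"
      by (simp add: fa_coprod_diff fa_tensor_diff_left)
    also have "\<dots> \<in> PJ_rep s q"
      by (rule PJ_rep_add[OF that(1)[unfolded good_def] PJ_rep_ideal[OF PP.I_diff[OF
          coprod_rel_ideal[OF q that(2)] \<iota>1_rel_ideal[OF that(2)]]]])
    finally show ?thesis by (simp add: good_def)
  qed
  have good_add: "good (f + g)" if "good f" "good g" for f g
    using PJ_rep_add[OF that[unfolded good_def]]
    by (simp add: good_def fa_coprod_add fa_tensor_add_left algebra_simps)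
  have good_minus: "good (- f)" if "good f" for f
    using PJ_rep_minus[OF that[unfolded good_def]]
    by (simp add: good_def fa_coprod_minus fa_tensor_minus_left)
  have good_mult: "good (f * g)" if "good f" "good g" for f g
  proof -
    have "fa_coprod (f * g) - \<iota>1 (f * g) = (fa_coprod f - \<iota>1 f) * fa_coprod g + \<iota>1 f * (fa_coprod g - \<iota>1 g)"
      by (simp add: fa_coprod_mult \<iota>1_mult algebra_simps)
    also have "\<dots> \<in> PJ_rep s q"
      using that unfolding good_def by (intro PJ_rep_add PJ_rep_right PJ_rep_left)
    finally show ?thesis by (simp add: good_def)
  qed
  have good_sc: "good (sc c)" for c
    by (simp add: good_def PJ_rep_ideal PP.I_zero)
  have V1: "v\<^sub>1 s q = \<delta> + sc s * - (sc q * \<gamma>)"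
    "fa_coprod (v\<^sub>1 s q) = \<iota>1 \<delta> * \<iota>2 (v\<^sub>1 s q) + \<iota>1 (- (sc q * \<gamma>)) * \<iota>2 (v\<^sub>2 s q)"
    by (simp add: v\<^sub>1_def sc_sc_left, simp add: uv_coprod[OF q] fa_tensor_minus_left)
  have V2: "v\<^sub>2 s q = - (sc (inverse q) * \<beta>) + sc s * \<alpha>"
    "fa_coprod (v\<^sub>2 s q) = \<iota>1 (- (sc (inverse q) * \<beta>)) * \<iota>2 (v\<^sub>1 s q) + \<iota>1 \<alpha> * \<iota>2 (v\<^sub>2 s q)"
    by (simp add: v\<^sub>2_def sc_sc_left, simp add: uv_coprod[OF q] fa_tensor_minus_left)
  have "good (u\<^sub>1 s * v\<^sub>1 s q)" "good (u\<^sub>1 s * v\<^sub>2 s q)" "good (u\<^sub>2 s * v\<^sub>1 s q)"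
    unfolding good_def
    by (rule coprod_uv[OF q u\<^sub>1_def uv_coprod(1)[OF q] V1] coprod_uv[OF q u\<^sub>1_def uv_coprod(1)[OF q] V2]
        coprod_uv[OF q u\<^sub>2_def uv_coprod(2)[OF q] V1])+
  then have gens: "good (\<xi> s q)" "good (\<eta> s q)" "good (\<zeta> s q)"
  proof -
    assume *: "good (u\<^sub>1 s * v\<^sub>1 s q)" "good (u\<^sub>1 s * v\<^sub>2 s q)" "good (u\<^sub>2 s * v\<^sub>1 s q)"
    show "good (\<xi> s q)" by (rule cong[OF *(2)]) (simp add: uv_products[OF q] P.I_left)
    have "good (- (u\<^sub>2 s * v\<^sub>1 s q))" "good (- (u\<^sub>1 s * v\<^sub>1 s q) + sc 1)"
      using * good_sc by (blast intro: good_minus good_add)+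
    note ** = this
    show "good (\<eta> s q)" by (rule cong[OF **(1)]) (simp add: uv_products[OF q] P.I_left)
    show "good (\<zeta> s q)" by (rule cong[OF **(2)]) (simp add: uv_products[OF q] P.I_left)
  qed
  have "A \<in> {pr q f | f. good f}" if "A \<in> S2 s q" for A
    using that unfolding S2_def
  proof (induction rule: generate_ring.induct)
    case one
    then show ?case using good_sc[of 1] by auto
  next
    case (incl h)
    then show ?case using gens good_sc by auto
  next
    case (a_inv h)
    then obtain f where "h = pr q f" "good f" by blast
    then show ?case using good_minus[of f] by auto
  next
    case (eng_add h1 h2)
    then obtain f g where "h1 = pr q f" "good f" "h2 = pr q g" "good g" by blast
    then show ?case using good_add[of f g] by auto
  next
    case (eng_mult h1 h2)
    then obtain f g where "h1 = pr q f" "good f" "h2 = pr q g" "good g" by blast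
    then show ?case using good_mult[of f g] by auto
  qed
  then obtain f where "pr q b = pr q f" "good f" using b unfolding S2_rep_def by blast
  then show ?thesis using cong[of f b] by (simp add: pr_eq_iff good_def)
qed

section \<open>The line bundle\<close>

lemma image_pairs_Collect:
  "{f x y | x y. x \<in> g ` U \<and> y \<in> g ` U} = {f (g x) (g y) | x y. x \<in> U \<and> y \<in> U}"
  by blast

lemma line_bundle_reps: "line_bundle s q = {pr q (x * u\<^sub>1 s + y * u\<^sub>2 s) | x y. x \<in> S2_rep s q \<and> y \<in> S2_rep s q}"
proof -
  have "line_comb s q (pr q x, pr q y) = pr q (x * u\<^sub>1 s + y * u\<^sub>2 s)" for x y
    by (simp add: line_comb_def u\<^sub>1_def u\<^sub>2_def)
  then show ?thesis unfolding line_bundle_def S2_reps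
    by (subst image_pairs_Collect[where f = "\<lambda>x y. line_comb s q (x, y)"]) (simp only:)
qed

locale hopf_params =
  fixes s q :: "'k::field"
  assumes q: "q \<noteq> 0" and s: "1 + s^2 \<noteq> 0"
begin

definition c :: 'k where "c = inverse (1 + s^2)"

abbreviation "U1 \<equiv> u\<^sub>1 s"
abbreviation "U2 \<equiv> u\<^sub>2 s"
abbreviation "V1 \<equiv> v\<^sub>1 s q"
abbreviation "V2 \<equiv> v\<^sub>2 s q"

lemma vu_rel_ideal: "V1 * U1 + V2 * U2 - sc (1 + s^2) \<in> rel_ideal q"
  unfolding vu_product[OF q] by (simp add: P.I_add P.I_diff P.I_left)

text \<open>
  Every p is recovered from the row \<open>p v / (1 + s\<^sup>2)\<close>. This makes \<open>\<Theta>\<close> well defined and injective,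
  and exhibits an element of the associated module as a combination of \<open>u\<^sub>1\<close> and \<open>u\<^sub>2\<close>.
\<close>

lemma vu_unit: "sc c * p * V1 * U1 + sc c * p * V2 * U2 - p \<in> rel_ideal q"
proof -
  define r where "r = V1 * U1 + V2 * U2 - sc (1 + s^2)"
  have r: "r \<in> rel_ideal q" unfolding r_def by (rule vu_rel_ideal)
  have cs: "c * (1 + s^2) = 1" using s by (simp add: c_def)
  have "sc c * p * V1 * U1 + sc c * p * V2 * U2 = sc c * p * (sc (1 + s^2) + r)"
    by (simp add: r_def algebra_simps)
  also have "\<dots> = sc c * p * sc (1 + s^2) + sc c * p * r" by (rule distrib_left)
  also have "sc c * p * sc (1 + s^2) = p"
    by (simp only: mult.assoc sc_central[of p] sc_sc_left cs sc_1 mult_1)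
  finally show ?thesis using r by (simp add: P.I_left)
qed

text \<open>
  Since \<open>u\<^sub>2 (v\<^sub>1 u\<^sub>1 + v\<^sub>2 u\<^sub>2) = (1 + s\<^sup>2) u\<^sub>2\<close> and the products \<open>u\<^sub>2 v\<^sub>k\<close> reduce to their counits
  modulo J, one gets \<open>s u\<^sub>1 + s\<^sup>2 u\<^sub>2 \<equiv> (1 + s\<^sup>2) u\<^sub>2\<close>. The same computation with \<open>u\<^sub>1\<close> on the left
  would only give s times this congruence.
\<close>

lemma U2_counit: "U2 - sc s * U1 \<in> Js_rep s q"
proof -
  have "U2 - sc s * U1 = (U2 * V1 - sc s) * U1 + (U2 * V2 - sc (s^2)) * U2
     - U2 * (V1 * U1 + V2 * U2 - sc (1 + s^2))"
    by (simp add: algebra_simps sc_add sc_central[of U2])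
  also have "\<dots> \<in> Js_rep s q"
    by (intro Js_rep_add Js_rep_diff Js_rep_right uv_counit[OF q] Js_rep_ideal P.I_left vu_rel_ideal)
  finally show ?thesis .
qed

lemma coprod_U: "fa_coprod U1 - fa_tensor U1 U1 \<in> PJ_rep s q" "fa_coprod U2 - fa_tensor U2 U1 \<in> PJ_rep s q"
proof -
  have "fa_tensor U1 w = fa_tensor \<alpha> w + sc s * fa_tensor \<beta> w"
    "fa_tensor U2 w = fa_tensor \<gamma> w + sc s * fa_tensor \<delta> w" for w
    by (simp_all add: u\<^sub>1_def u\<^sub>2_def fa_tensor_linear)
  then have "fa_coprod U1 - fa_tensor U1 U1 = fa_tensor \<beta> (U2 - sc s * U1)"
    "fa_coprod U2 - fa_tensor U2 U1 = fa_tensor \<delta> (U2 - sc s * U1)"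
    by (simp_all add: uv_coprod[OF q] fa_tensor_mult fa_tensor_diff_right fa_tensor_scale_right)
  then show "fa_coprod U1 - fa_tensor U1 U1 \<in> PJ_rep s q" "fa_coprod U2 - fa_tensor U2 U1 \<in> PJ_rep s q"
    by (simp_all add: PJ_rep_tensor U2_counit)
qed

lemma coprod_line:
  assumes "x \<in> S2_rep s q" "y \<in> S2_rep s q"
  shows "fa_coprod (x * U1 + y * U2) - fa_tensor (x * U1 + y * U2) U1 \<in> PJ_rep s q"
proof -
  have split: "fa_tensor (f * g) U1 = \<iota>1 f * fa_tensor g U1" for f g
    by (simp add: fa_tensor_mult)
  have "fa_coprod (x * U1 + y * U2) - fa_tensor (x * U1 + y * U2) U1 =
     ((fa_coprod x - \<iota>1 x) * fa_coprod U1 + \<iota>1 x * (fa_coprod U1 - fa_tensor U1 U1)) +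
     ((fa_coprod y - \<iota>1 y) * fa_coprod U2 + \<iota>1 y * (fa_coprod U2 - fa_tensor U2 U1))"
    unfolding fa_tensor_add_left split fa_coprod_add fa_coprod_mult by (simp add: algebra_simps)
  also have "\<dots> \<in> PJ_rep s q"
    using coprod_S2_rep[OF q assms(1)] coprod_S2_rep[OF q assms(2)]
    by (intro PJ_rep_add PJ_rep_right PJ_rep_left coprod_U)
  finally show ?thesis .
qed

text \<open>
  Modulo P \<open>\<otimes>\<close> J, \<open>\<Delta>(p v r)\<close> is \<open>(p \<otimes> u\<^sub>1) \<Delta>(v) \<Delta>(r)\<close>. The factor \<open>(1 \<otimes> u\<^sub>1) \<Delta>(v)\<close> has second
  legs among the products \<open>u\<^sub>1 v\<^sub>k\<close>, which reduce to their counits and leave \<open>v \<otimes> 1\<close>.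
\<close>

lemma coinvariant_multiple:
  assumes p: "fa_coprod p - fa_tensor p U1 \<in> PJ_rep s q"
    and V: "fa_tensor 1 U1 * fa_coprod v - \<iota>1 v \<in> PJ_rep s q"
  shows "pr q (p * v) \<in> coinvariants s q"
  unfolding coinvariants_iff[OF q]
proof
  fix f
  have "fa_coprod (p * v * f) - \<iota>1 (p * v) * fa_coprod f =
      (fa_coprod p - fa_tensor p U1) * (fa_coprod v * fa_coprod f)
      + \<iota>1 p * ((fa_tensor 1 U1 * fa_coprod v - \<iota>1 v) * fa_coprod f)"
    unfolding fa_tensor_eq[of p U1] by (simp add: \<iota>1_mult fa_coprod_mult algebra_simps)
  also have "\<dots> \<in> PJ_rep s q" using p V by (intro PJ_rep_add PJ_rep_left PJ_rep_right)
  finally show "fa_coprod (p * v * f) - \<iota>1 (p * v) * fa_coprod f \<in> PJ_rep s q" .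
qed

lemma U1_coprod_V: "\<iota>2 U1 * fa_coprod V1 - \<iota>1 V1 \<in> PJ_rep s q" "\<iota>2 U1 * fa_coprod V2 - \<iota>1 V2 \<in> PJ_rep s q"
proof -
  have scal: "fa_tensor f (sc a) = sc a * \<iota>1 f" for f :: "'k fa" and a
    using fa_tensor_scale_right[of f a 1] by simp
  have V: "\<iota>1 V1 = \<iota>1 \<delta> - sc s * \<iota>1 (sc q * \<gamma>)" "\<iota>1 V2 = sc s * \<iota>1 \<alpha> - \<iota>1 (sc (inverse q) * \<beta>)"
    by (simp_all add: v\<^sub>1_def v\<^sub>2_def fa_tensor_linear sc_sc_left)
  have "\<iota>2 U1 * fa_coprod V1 - \<iota>1 V1 =
      fa_tensor \<delta> (U1 * V1 - 1) - fa_tensor (sc q * \<gamma>) (U1 * V2 - sc s)"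
    unfolding uv_coprod[OF q] V fa_tensor_diff_right scal by (simp add: right_diff_distrib fa_tensor_mult)
  also have "\<dots> \<in> PJ_rep s q" by (intro PJ_rep_diff PJ_rep_tensor uv_counit[OF q])
  finally show "\<iota>2 U1 * fa_coprod V1 - \<iota>1 V1 \<in> PJ_rep s q" .
  have "\<iota>2 U1 * fa_coprod V2 - \<iota>1 V2 =
      fa_tensor \<alpha> (U1 * V2 - sc s) - fa_tensor (sc (inverse q) * \<beta>) (U1 * V1 - 1)"
    unfolding uv_coprod[OF q] V fa_tensor_diff_right scal by (simp add: right_diff_distrib fa_tensor_mult)
  also have "\<dots> \<in> PJ_rep s q" by (intro PJ_rep_diff PJ_rep_tensor uv_counit[OF q])
  finally show "\<iota>2 U1 * fa_coprod V2 - \<iota>1 V2 \<in> PJ_rep s q" .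
qed

lemma line_bundle_associated: "line_bundle s q \<subseteq> associated_module s q (gplus s q 1)"
proof
  fix A assume "A \<in> line_bundle s q"
  then obtain x y where "A = pr q (x * U1 + y * U2)" "x \<in> S2_rep s q" "y \<in> S2_rep s q"
    unfolding line_bundle_reps by blast
  then show "A \<in> associated_module s q (gplus s q 1)"
    unfolding \<open>A = _\<close> associated_module_iff[OF q] by (intro coprod_line)
qed

lemma associated_line_bundle:
  assumes "coinvariants s q = S2 s q"
  shows "associated_module s q (gplus s q 1) \<subseteq> line_bundle s q"
proof
  fix A assume A: "A \<in> associated_module s q (gplus s q 1)"
  then obtain p where p: "A = pr q p"
    unfolding associated_module_def carrier_SUq2 by blast
  have cop: "fa_coprod p - fa_tensor p U1 \<in> PJ_rep s q"
    using A unfolding p associated_module_iff[OF q] .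
  have "p * V1 \<in> S2_rep s q" "p * V2 \<in> S2_rep s q"
    using coinvariant_multiple[OF cop U1_coprod_V(1)] coinvariant_multiple[OF cop U1_coprod_V(2)]
    by (simp_all add: assms S2_rep_def)
  then have "sc c * (p * V1) \<in> S2_rep s q" "sc c * (p * V2) \<in> S2_rep s q"
    by (simp_all add: S2_rep_mult)
  moreover have "A = pr q (sc c * (p * V1) * U1 + sc c * (p * V2) * U2)"
    unfolding p using vu_unit[of p, folded pr_eq_iff] by (simp add: mult.assoc)
  ultimately show "A \<in> line_bundle s q" unfolding line_bundle_reps by blast
qed

section \<open>The projector and \<open>\<Theta>\<close>\<close>

definition "E11 = sc c * (1 - \<zeta> s q)"
definition "E12 = sc c * \<xi> s q"
definition "E21 = sc c * (- \<eta> s q)"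
definition "E22 = sc c * (sc (s^2) + sc (inverse q ^ 2) * \<zeta> s q)"

lemmas E_defs = E11_def E12_def E21_def E22_def

lemma projector_pr: "projector s q = ((pr q E11, pr q E12), (pr q E21, pr q E22))"
  by (simp add: projector_def E_defs c_def)

lemma E_S2_rep: "E11 \<in> S2_rep s q" "E12 \<in> S2_rep s q" "E21 \<in> S2_rep s q" "E22 \<in> S2_rep s q"
  unfolding E_defs by (intro S2_rep_mult S2_rep_sc S2_rep_diff S2_rep_minus S2_rep_add S2_rep_gens S2_rep_1)+

lemma uv_E:
  "sc c * U1 * V1 - E11 \<in> rel_ideal q" "sc c * U1 * V2 - E12 \<in> rel_ideal q"
  "sc c * U2 * V1 - E21 \<in> rel_ideal q" "sc c * U2 * V2 - E22 \<in> rel_ideal q"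
  unfolding E_defs mult.assoc[of "sc c" "u\<^sub>1 s"] mult.assoc[of "sc c" "u\<^sub>2 s"] uv_products[OF q] right_diff_distrib[symmetric]
  by (auto intro!: P.I_left[of _ q "sc c"] simp: P.I_left P.I_diff P.I_add P.I_minus)

lemma row_E:
  "sc c * (x * U1 + y * U2) * V1 - (x * E11 + y * E21) \<in> rel_ideal q"
  "sc c * (x * U1 + y * U2) * V2 - (x * E12 + y * E22) \<in> rel_ideal q"
proof -
  have "sc c * (x * U1 + y * U2) * V1 - (x * E11 + y * E21) =
      x * (sc c * U1 * V1 - E11) + y * (sc c * U2 * V1 - E21)"
    by (simp add: algebra_simps sc_left_commute[of x] sc_left_commute[of y])
  also have "\<dots> \<in> rel_ideal q" by (intro P.I_add P.I_left uv_E)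
  finally show "sc c * (x * U1 + y * U2) * V1 - (x * E11 + y * E21) \<in> rel_ideal q" .
  have "sc c * (x * U1 + y * U2) * V2 - (x * E12 + y * E22) =
      x * (sc c * U1 * V2 - E12) + y * (sc c * U2 * V2 - E22)"
    by (simp add: algebra_simps sc_left_commute[of x] sc_left_commute[of y])
  also have "\<dots> \<in> rel_ideal q" by (intro P.I_add P.I_left uv_E)
  finally show "sc c * (x * U1 + y * U2) * V2 - (x * E12 + y * E22) \<in> rel_ideal q" .
qed

lemma E_U: "E11 * U1 + E12 * U2 - U1 \<in> rel_ideal q" "E21 * U1 + E22 * U2 - U2 \<in> rel_ideal q"
proof -
  have "E11 * U1 + E12 * U2 - U1 = (sc c * U1 * V1 * U1 + sc c * U1 * V2 * U2 - U1)
      - (sc c * U1 * V1 - E11) * U1 - (sc c * U1 * V2 - E12) * U2"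
    by (simp add: algebra_simps)
  also have "\<dots> \<in> rel_ideal q"
    by (rule P.I_diff[OF P.I_diff[OF vu_unit P.I_right[OF uv_E(1)]] P.I_right[OF uv_E(2)]])
  finally show "E11 * U1 + E12 * U2 - U1 \<in> rel_ideal q" .
  have "E21 * U1 + E22 * U2 - U2 = (sc c * U2 * V1 * U1 + sc c * U2 * V2 * U2 - U2)
      - (sc c * U2 * V1 - E21) * U1 - (sc c * U2 * V2 - E22) * U2"
    by (simp add: algebra_simps)
  also have "\<dots> \<in> rel_ideal q"
    by (rule P.I_diff[OF P.I_diff[OF vu_unit P.I_right[OF uv_E(3)]] P.I_right[OF uv_E(4)]])
  finally show "E21 * U1 + E22 * U2 - U2 \<in> rel_ideal q" .
qed

text \<open>
  The row \<open>p v / (1 + s\<^sup>2)\<close>: the inverse of \<open>\<Theta>\<close>, defined on all of P.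
\<close>

definition coords :: "'k fa \<Rightarrow> 'k fa set \<times> 'k fa set" where
  "coords p = (pr q (sc c * p * V1), pr q (sc c * p * V2))"

lemma row_mult_projector:
  "row_mult (SUq2 q) (pr q x, pr q y) (projector s q) = coords (x * U1 + y * U2)"
  unfolding projector_pr coords_def row_mult_def
  using row_E[of x y, folded pr_eq_iff] by simp

lemma coords_eq_iff: "coords p = coords p' \<longleftrightarrow> pr q p = pr q p'"
proof
  assume "pr q p = pr q p'"
  then have "p - p' \<in> rel_ideal q" by (simp add: pr_eq_iff)
  then have "sc c * (p - p') * v \<in> rel_ideal q" for v by (intro P.I_left P.I_right)
  then show "coords p = coords p'" by (simp add: coords_def pr_eq_iff algebra_simps)
next
  have recover: "pr q p = fst (coords p) \<otimes>\<^bsub>SUq2 q\<^esub> pr q U1 \<oplus>\<^bsub>SUq2 q\<^esub> snd (coords p) \<otimes>\<^bsub>SUq2 q\<^esub> pr q U2" for p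
    unfolding coords_def fst_conv snd_conv pr_mult pr_add by (rule vu_unit[of p, folded pr_eq_iff, symmetric])
  assume "coords p = coords p'"
  then show "pr q p = pr q p'" using recover[of p] recover[of p'] by simp
qed

lemma proj_module_reps: "proj_module s q = {coords (x * U1 + y * U2) | x y. x \<in> S2_rep s q \<and> y \<in> S2_rep s q}"
proof -
  show ?thesis unfolding proj_module_def S2_reps
    by (subst image_pairs_Collect[where f = "\<lambda>x y. row_mult (SUq2 q) (x, y) (projector s q)"])
      (simp only: row_mult_projector)
qed

lemma line_comb_pr: "line_comb s q (pr q x, pr q y) = pr q (x * U1 + y * U2)"
  by (simp add: line_comb_def u\<^sub>1_def u\<^sub>2_def)

lemma Theta_coords:
  assumes "x \<in> S2_rep s q" "y \<in> S2_rep s q"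
  shows "Theta s q (coords (x * U1 + y * U2)) = pr q (x * U1 + y * U2)"
  unfolding Theta_def S2_reps
proof (rule the_equality)
  show "\<exists>x'\<in>pr q ` S2_rep s q. \<exists>y'\<in>pr q ` S2_rep s q. coords (x * U1 + y * U2) = row_mult (SUq2 q) (x', y') (projector s q)
      \<and> pr q (x * U1 + y * U2) = line_comb s q (x', y')"
    by (rule bexI[of _ "pr q x"], rule bexI[of _ "pr q y"])
      (simp_all add: row_mult_projector line_comb_pr assms)
  fix A assume "\<exists>x'\<in>pr q ` S2_rep s q. \<exists>y'\<in>pr q ` S2_rep s q. coords (x * U1 + y * U2) = row_mult (SUq2 q) (x', y') (projector s q)
      \<and> A = line_comb s q (x', y')"
  then obtain x' y' where "coords (x * U1 + y * U2) = coords (x' * U1 + y' * U2)" "A = pr q (x' * U1 + y' * U2)"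
    by (auto simp: row_mult_projector line_comb_pr)
  then show "A = pr q (x * U1 + y * U2)" by (simp add: coords_eq_iff)
qed

lemma Theta_bij: "bij_betw (Theta s q) (proj_module s q) (line_bundle s q)"
  unfolding bij_betw_def
proof
  show "inj_on (Theta s q) (proj_module s q)"
  proof (rule inj_onI)
    fix v w assume "v \<in> proj_module s q" "w \<in> proj_module s q" and eq: "Theta s q v = Theta s q w"
    then obtain x y x' y' where vw: "v = coords (x * U1 + y * U2)" "w = coords (x' * U1 + y' * U2)"
      "x \<in> S2_rep s q" "y \<in> S2_rep s q" "x' \<in> S2_rep s q" "y' \<in> S2_rep s q"
      unfolding proj_module_reps by blast
    then show "v = w" using eq by (simp add: Theta_coords coords_eq_iff)
  qed
  show "Theta s q ` proj_module s q = line_bundle s q"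
  proof (intro equalityI subsetI)
    fix A assume "A \<in> Theta s q ` proj_module s q"
    then obtain x y where xy: "A = Theta s q (coords (x * U1 + y * U2))" "x \<in> S2_rep s q" "y \<in> S2_rep s q"
      unfolding proj_module_reps by blast
    then have "A = pr q (x * U1 + y * U2)" by (simp add: Theta_coords)
    with xy show "A \<in> line_bundle s q" unfolding line_bundle_reps by blast
  next
    fix A assume "A \<in> line_bundle s q"
    then obtain x y where "A = pr q (x * U1 + y * U2)" "x \<in> S2_rep s q" "y \<in> S2_rep s q"
      unfolding line_bundle_reps by blast
    then have "A = Theta s q (coords (x * U1 + y * U2))" "coords (x * U1 + y * U2) \<in> proj_module s q"
      unfolding proj_module_reps by (simp add: Theta_coords, blast)
    then show "A \<in> Theta s q ` proj_module s q" by blast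
  qed
qed

end

section \<open>One-forms\<close>

lemma bilinear_times: "bilinear_fa (\<lambda>f g. f * g)"
  by (simp add: bilinear_fa_def distrib_left distrib_right mult.assoc sc_left_commute)

abbreviation mulF :: "'k::field fa2 \<Rightarrow> 'k fa" where "mulF \<equiv> bil (\<lambda>f g. f * g)"

lemma mulF_sum: "mulF (\<Sum>i\<in>A. fa_tensor (f i) (g i)) = (\<Sum>i\<in>A. f i * g i)"
  by (simp add: bil_def lin_sum) (simp add: bil_def[symmetric] bil_tensor[OF bilinear_times])

lemma mulF_bimodule: "mulF (\<iota>1 a * T * \<iota>2 b) = a * mulF T * b"
proof (induction T rule: fa2_induct)
  case (tensor f g)
  then show ?case by (simp add: fa_tensor_mult bil_tensor[OF bilinear_times] mult.assoc)
qed (simp add: distrib_left distrib_right bil_add)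

lemma finsum_mult_pr:
  assumes "\<And>i. i < n \<Longrightarrow> x i = pr q (x' i)" "\<And>i. i < n \<Longrightarrow> y i = pr q (y' i)"
  shows "(\<Oplus>\<^bsub>SUq2 q\<^esub>i\<in>{..<n::nat}. x i \<otimes>\<^bsub>SUq2 q\<^esub> y i) = pr q (\<Sum>i<n. x' i * y' i)"
proof -
  interpret ring "SUq2 q" by (rule ring_SUq2)
  have "(\<Oplus>\<^bsub>SUq2 q\<^esub>i\<in>{..<n}. x i \<otimes>\<^bsub>SUq2 q\<^esub> y i) = (\<Oplus>\<^bsub>SUq2 q\<^esub>i\<in>{..<n}. pr q (x' i * y' i))"
    using assms by (intro finsum_cong') (auto simp: carrier_SUq2)
  then show ?thesis by (simp add: pr_finsum)
qed

lemma Omega1_reps: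
  assumes A: "A \<subseteq> carrier (SUq2 q)"
  shows "Omega1 q A = pr2 q ` {T \<in> sums_of {fa_tensor f g | f g. pr q f \<in> A \<and> pr q g \<in> A}. mulF T \<in> rel_ideal q}"
    (is "_ = ?R")
proof (intro equalityI subsetI)
  fix Z assume "Z \<in> Omega1 q A"
  then obtain n :: nat and x y where xy: "x \<in> {..<n} \<rightarrow> A" "y \<in> {..<n} \<rightarrow> A"
    and Z: "Z = (\<Oplus>\<^bsub>PP q\<^esub>i\<in>{..<n}. tensor q (x i) (y i))"
    and m: "(\<Oplus>\<^bsub>SUq2 q\<^esub>i\<in>{..<n}. x i \<otimes>\<^bsub>SUq2 q\<^esub> y i) = \<zero>\<^bsub>SUq2 q\<^esub>"
    unfolding Omega1_def mem_Collect_eq by (elim exE conjE) (rule that)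
  obtain x' where x': "\<And>i. i < n \<Longrightarrow> x i = pr q (x' i)" "\<And>i. i < n \<Longrightarrow> pr q (x' i) \<in> A"
    by (rule SUq2_reps[OF xy(1) A], rule that)
  obtain y' where y': "\<And>i. i < n \<Longrightarrow> y i = pr q (y' i)" "\<And>i. i < n \<Longrightarrow> pr q (y' i) \<in> A"
    by (rule SUq2_reps[OF xy(2) A], rule that)
  have Z': "Z = pr2 q (\<Sum>i<n. fa_tensor (x' i) (y' i))"
    unfolding Z by (rule finsum_tensor_pr[OF x'(1) y'(1)])
  have "pr q (\<Sum>i<n. x' i * y' i) = pr q 0"
    using m finsum_mult_pr[of n x q x' y y', OF x'(1) y'(1)] by simp
  then have "mulF (\<Sum>i<n. fa_tensor (x' i) (y' i)) \<in> rel_ideal q"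
    by (simp add: mulF_sum pr_eq_iff)
  moreover have "(\<Sum>i<n. fa_tensor (x' i) (y' i)) \<in> sums_of {fa_tensor f g | f g. pr q f \<in> A \<and> pr q g \<in> A}"
    by (rule sums_ofI) (use x'(2) y'(2) in blast)
  ultimately show "Z \<in> ?R" unfolding Z' by (intro imageI CollectI conjI)
next
  fix Z assume "Z \<in> ?R"
  then obtain T where T: "T \<in> sums_of {fa_tensor f g | f g. pr q f \<in> A \<and> pr q g \<in> A}"
    and m: "mulF T \<in> rel_ideal q" and Z: "Z = pr2 q T" by blast
  obtain n :: nat and z where z: "\<forall>i<n. z i \<in> {fa_tensor f g | f g. pr q f \<in> A \<and> pr q g \<in> A}"
    and Tz: "T = (\<Sum>i<n. z i)" using T unfolding sums_of_def by blast
  have "\<exists>f g. z i = fa_tensor f g \<and> pr q f \<in> A \<and> pr q g \<in> A" if "i < n" for i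
    using that z by blast
  then obtain x y where xy: "\<And>i. i < n \<Longrightarrow> z i = fa_tensor (x i) (y i) \<and> pr q (x i) \<in> A \<and> pr q (y i) \<in> A"
    by metis
  have Txy: "T = (\<Sum>i<n. fa_tensor (x i) (y i))" unfolding Tz using xy by simp
  have "Z = (\<Oplus>\<^bsub>PP q\<^esub>i\<in>{..<n}. tensor q (pr q (x i)) (pr q (y i)))"
    unfolding Z Txy by (rule finsum_tensor_pr[symmetric]) simp_all
  moreover have "(\<Oplus>\<^bsub>SUq2 q\<^esub>i\<in>{..<n}. pr q (x i) \<otimes>\<^bsub>SUq2 q\<^esub> pr q (y i)) = \<zero>\<^bsub>SUq2 q\<^esub>"
    using m unfolding Txy mulF_sum
    by (subst finsum_mult_pr[of n _ q x _ y]) (simp_all add: pr_eq_iff)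
  moreover have "(\<lambda>i. pr q (x i)) \<in> {..<n} \<rightarrow> A" "(\<lambda>i. pr q (y i)) \<in> {..<n} \<rightarrow> A"
    using xy by auto
  ultimately show "Z \<in> Omega1 q A" unfolding Omega1_def
    by (intro CollectI exI[of _ n] exI[of _ "\<lambda>i. pr q (x i)"] exI[of _ "\<lambda>i. pr q (y i)"] conjI)
qed

definition Om_rep :: "'k::field \<Rightarrow> 'k \<Rightarrow> 'k fa2 set" where "Om_rep s q = {T. pr2 q T \<in> Omega1 q (S2 s q)}"

lemma Om_rep_iff: "T \<in> Om_rep s q \<longleftrightarrow> (\<exists>S \<in> sums_of {fa_tensor f g | f g. f \<in> S2_rep s q \<and> g \<in> S2_rep s q}.
    mulF S \<in> rel_ideal q \<and> T - S \<in> rel_ideal2 q)"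
  unfolding Om_rep_def Omega1_reps[OF S2_carrier] S2_rep_def by (auto simp: pr2_eq_iff image_iff)

lemma Omega1_S2_reps: "Omega1 q (S2 s q) = pr2 q ` Om_rep s q"
  unfolding Om_rep_def using Omega1_reps[OF S2_carrier, of q s] by auto

lemma Om_repI:
  "S \<in> sums_of {fa_tensor f g | f g. f \<in> S2_rep s q \<and> g \<in> S2_rep s q} \<Longrightarrow> mulF S \<in> rel_ideal q \<Longrightarrow>
    T - S \<in> rel_ideal2 q \<Longrightarrow> T \<in> Om_rep s q"
  unfolding Om_rep_iff by blast

lemma Om_repE:
  assumes "T \<in> Om_rep s q"
  obtains S where "S \<in> sums_of {fa_tensor f g | f g. f \<in> S2_rep s q \<and> g \<in> S2_rep s q}"
    "mulF S \<in> rel_ideal q" "T - S \<in> rel_ideal2 q"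
  using assms unfolding Om_rep_iff by blast

lemma Om_rep_0: "0 \<in> Om_rep s q"
  by (rule Om_repI[of 0]) (simp_all add: sums_of_zero P.I_zero PP.I_zero)

lemma Om_rep_add:
  assumes "T \<in> Om_rep s q" "T' \<in> Om_rep s q"
  shows "T + T' \<in> Om_rep s q"
proof -
  obtain S where S: "S \<in> sums_of {fa_tensor f g | f g. f \<in> S2_rep s q \<and> g \<in> S2_rep s q}"
    "mulF S \<in> rel_ideal q" "T - S \<in> rel_ideal2 q" by (rule Om_repE[OF assms(1)])
  obtain S' where S': "S' \<in> sums_of {fa_tensor f g | f g. f \<in> S2_rep s q \<and> g \<in> S2_rep s q}"
    "mulF S' \<in> rel_ideal q" "T' - S' \<in> rel_ideal2 q" by (rule Om_repE[OF assms(2)])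
  have "(T + T') - (S + S') \<in> rel_ideal2 q"
    using PP.I_add[OF S(3) S'(3)] by (simp add: algebra_simps)
  then show ?thesis using S S'
    by (intro Om_repI[of "S + S'"]) (simp_all add: sums_of_add bil_add P.I_add PP.I_add)
qed

lemma Om_rep_sum: "(\<And>i. i \<in> A \<Longrightarrow> T i \<in> Om_rep s q) \<Longrightarrow> (\<Sum>i\<in>A. T i) \<in> Om_rep s q"
  by (induction A rule: infinite_finite_induct) (simp_all add: Om_rep_0 Om_rep_add)

lemma Om_rep_bimodule:
  assumes "T \<in> Om_rep s q" "a \<in> S2_rep s q" "b \<in> S2_rep s q"
  shows "\<iota>1 a * T * \<iota>2 b \<in> Om_rep s q"
proof -
  obtain S where S: "S \<in> sums_of {fa_tensor f g | f g. f \<in> S2_rep s q \<and> g \<in> S2_rep s q}"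
    "mulF S \<in> rel_ideal q" "T - S \<in> rel_ideal2 q" by (rule Om_repE[OF assms(1)])
  have 1: "\<iota>1 a * S * \<iota>2 b \<in> sums_of {fa_tensor f g | f g. f \<in> S2_rep s q \<and> g \<in> S2_rep s q}"
  proof (rule sums_of_map[OF S(1), where h = "\<lambda>S. \<iota>1 a * S * \<iota>2 b"])
    fix x assume "x \<in> {fa_tensor f g | f g. f \<in> S2_rep s q \<and> g \<in> S2_rep s q}"
    then obtain f g where "x = fa_tensor f g" "f \<in> S2_rep s q" "g \<in> S2_rep s q" by blast
    then have "\<iota>1 a * x * \<iota>2 b = fa_tensor (a * f) (g * b)" "a * f \<in> S2_rep s q" "g * b \<in> S2_rep s q"
      using assms by (simp_all add: fa_tensor_mult S2_rep_mult)
    then show "\<iota>1 a * x * \<iota>2 b \<in> sums_of {fa_tensor f g | f g. f \<in> S2_rep s q \<and> g \<in> S2_rep s q}"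
      by (intro sums_of_incl) blast
  qed (simp_all add: distrib_left distrib_right)
  have "\<iota>1 a * T * \<iota>2 b - \<iota>1 a * S * \<iota>2 b = \<iota>1 a * (T - S) * \<iota>2 b" by (simp add: algebra_simps)
  also have "\<dots> \<in> rel_ideal2 q" using S(3) by (intro PP.I_right PP.I_left)
  finally have 2: "\<iota>1 a * T * \<iota>2 b - \<iota>1 a * S * \<iota>2 b \<in> rel_ideal2 q" .
  have "mulF (\<iota>1 a * S * \<iota>2 b) \<in> rel_ideal q"
    unfolding mulF_bimodule using S(2) by (intro P.I_right P.I_left)
  from Om_repI[OF 1 this 2] show ?thesis .
qed

lemma Om_rep_left: "T \<in> Om_rep s q \<Longrightarrow> a \<in> S2_rep s q \<Longrightarrow> \<iota>1 a * T \<in> Om_rep s q"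
  and Om_rep_right: "T \<in> Om_rep s q \<Longrightarrow> b \<in> S2_rep s q \<Longrightarrow> T * \<iota>2 b \<in> Om_rep s q"
  using Om_rep_bimodule[of T s q a 1] Om_rep_bimodule[of T s q 1 b] by simp_all

lemma Om_rep_d:
  assumes "b \<in> S2_rep s q"
  shows "\<iota>2 b - \<iota>1 b \<in> Om_rep s q"
proof (rule Om_repI)
  show "fa_tensor 1 b + fa_tensor (- b) 1 \<in> sums_of {fa_tensor f g | f g. f \<in> S2_rep s q \<and> g \<in> S2_rep s q}"
    using S2_rep_minus[OF assms] assms S2_rep_1 by (intro sums_of_add sums_of_incl) blast+
  show "mulF (fa_tensor 1 b + fa_tensor (- b) 1) \<in> rel_ideal q"
    by (simp add: bil_add bil_tensor[OF bilinear_times] P.I_zero)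
  show "\<iota>2 b - \<iota>1 b - (fa_tensor 1 b + fa_tensor (- b) 1) \<in> rel_ideal2 q"
    by (simp add: fa_tensor_minus_left PP.I_zero)
qed

section \<open>One-forms with values in the line bundle\<close>

context hopf_params begin

text \<open>
  The same inverse for one-forms: \<open>v\<close> acts on the second leg.
\<close>

definition form_coords :: "'k fa2 \<Rightarrow> 'k fa2 set \<times> 'k fa2 set" where
  "form_coords T = (pr2 q (T * \<iota>2 (sc c * V1)), pr2 q (T * \<iota>2 (sc c * V2)))"

lemma form_row_mult_projector:
  "form_row_mult q (pr2 q A, pr2 q B) (projector s q) = form_coords (A * \<iota>2 U1 + B * \<iota>2 U2)"
proof -
  have E: "U1 * (sc c * V1) - E11 \<in> rel_ideal q" "U1 * (sc c * V2) - E12 \<in> rel_ideal q"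
    "U2 * (sc c * V1) - E21 \<in> rel_ideal q" "U2 * (sc c * V2) - E22 \<in> rel_ideal q"
    using uv_E by (simp_all add: mult.assoc sc_left_commute[of U1] sc_left_commute[of U2])
  have *: "pr2 q (A * \<iota>2 e + B * \<iota>2 e') = pr2 q ((A * \<iota>2 U1 + B * \<iota>2 U2) * \<iota>2 v)"
    if "U1 * v - e \<in> rel_ideal q" "U2 * v - e' \<in> rel_ideal q" for e e' v
  proof -
    have "(A * \<iota>2 U1 + B * \<iota>2 U2) * \<iota>2 v - (A * \<iota>2 e + B * \<iota>2 e') =
        A * \<iota>2 (U1 * v - e) + B * \<iota>2 (U2 * v - e')"
      by (simp add: fa_tensor_diff_right \<iota>2_mult algebra_simps)
    also have "\<dots> \<in> rel_ideal2 q"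
      using that by (intro PP.I_add PP.I_left \<iota>2_rel_ideal)
    finally show ?thesis by (intro sym[of "pr2 q ((A * \<iota>2 U1 + B * \<iota>2 U2) * \<iota>2 v)"]) (simp only: pr2_eq_iff)
  qed
  show ?thesis
    unfolding projector_pr form_row_mult_def form_coords_def row_mult_def pr_one
    using *[OF E(1,3)] *[OF E(2,4)] by (simp add: tensor_pr)
qed

lemma form_coords_eq_iff: "form_coords T = form_coords T' \<longleftrightarrow> pr2 q T = pr2 q T'"
proof
  assume "pr2 q T = pr2 q T'"
  then have "T - T' \<in> rel_ideal2 q" by (simp add: pr2_eq_iff)
  then have "(T - T') * R \<in> rel_ideal2 q" for R by (rule PP.I_right)
  then show "form_coords T = form_coords T'" by (simp add: form_coords_def pr2_eq_iff left_diff_distrib)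
next
  have recover: "fst (form_coords T) \<otimes>\<^bsub>PP q\<^esub> pr2 q (\<iota>2 U1) \<oplus>\<^bsub>PP q\<^esub> snd (form_coords T) \<otimes>\<^bsub>PP q\<^esub> pr2 q (\<iota>2 U2) = pr2 q T" for T
  proof -
    have "T * \<iota>2 (sc c * V1) * \<iota>2 U1 + T * \<iota>2 (sc c * V2) * \<iota>2 U2 - T
        = T * \<iota>2 (sc c * 1 * V1 * U1 + sc c * 1 * V2 * U2 - 1)"
      by (simp add: fa_tensor_diff_right fa_tensor_add_right \<iota>2_mult algebra_simps)
    also have "\<dots> \<in> rel_ideal2 q" by (intro PP.I_left \<iota>2_rel_ideal vu_unit)
    finally show ?thesis
      unfolding form_coords_def fst_conv snd_conv pr2_mult pr2_add pr2_eq_iff .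
  qed
  assume "form_coords T = form_coords T'"
  then show "pr2 q T = pr2 q T'" using recover[of T] recover[of T'] by simp
qed

lemma form_proj_module_reps:
  "form_proj_module s q = {form_coords (A * \<iota>2 U1 + B * \<iota>2 U2) | A B. A \<in> Om_rep s q \<and> B \<in> Om_rep s q}"
  unfolding form_proj_module_def Omega1_S2_reps
  by (subst image_pairs_Collect[where f = "\<lambda>x y. form_row_mult q (x, y) (projector s q)"])
    (simp only: form_row_mult_projector)

lemma Theta_basis:
  "Theta s q (row_mult (SUq2 q) (\<one>\<^bsub>SUq2 q\<^esub>, \<zero>\<^bsub>SUq2 q\<^esub>) (projector s q)) = pr q U1"
  "Theta s q (row_mult (SUq2 q) (\<zero>\<^bsub>SUq2 q\<^esub>, \<one>\<^bsub>SUq2 q\<^esub>) (projector s q)) = pr q U2"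
  using Theta_coords[of 1 0] Theta_coords[of 0 1]
  unfolding pr_one pr_zero row_mult_projector by simp_all

lemma id_Theta_coords:
  assumes "A \<in> Om_rep s q" "B \<in> Om_rep s q"
  shows "id_Theta s q (form_coords (A * \<iota>2 U1 + B * \<iota>2 U2)) = pr2 q (A * \<iota>2 U1 + B * \<iota>2 U2)"
  unfolding id_Theta_def Omega1_S2_reps Theta_basis
proof (rule the_equality)
  let ?P = "\<lambda>z r1 r2. form_coords (A * \<iota>2 U1 + B * \<iota>2 U2) = form_row_mult q (r1, r2) (projector s q) \<and>
      z = ract q r1 (pr q U1) \<oplus>\<^bsub>PP q\<^esub> ract q r2 (pr q U2)"
  show "\<exists>r1\<in>pr2 q ` Om_rep s q. \<exists>r2\<in>pr2 q ` Om_rep s q. ?P (pr2 q (A * \<iota>2 U1 + B * \<iota>2 U2)) r1 r2"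
    by (rule bexI[of _ "pr2 q A"], rule bexI[of _ "pr2 q B"])
      (simp_all add: form_row_mult_projector ract_pr assms)
  fix z assume "\<exists>r1\<in>pr2 q ` Om_rep s q. \<exists>r2\<in>pr2 q ` Om_rep s q. ?P z r1 r2"
  then obtain A' B' where "form_coords (A * \<iota>2 U1 + B * \<iota>2 U2) = form_coords (A' * \<iota>2 U1 + B' * \<iota>2 U2)"
    "z = pr2 q (A' * \<iota>2 U1 + B' * \<iota>2 U2)"
    by (auto simp: form_row_mult_projector ract_pr)
  then show "z = pr2 q (A * \<iota>2 U1 + B * \<iota>2 U2)" by (simp add: form_coords_eq_iff)
qed

lemma form_line_bundle_reps:
  "form_line_bundle s q = {pr2 q (A * \<iota>2 U1 + B * \<iota>2 U2) | A B. A \<in> Om_rep s q \<and> B \<in> Om_rep s q}"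
proof (intro equalityI subsetI)
  interpret ring "PP q" by (rule ring_PP)
  have U: "pr q U1 \<in> line_bundle s q" "pr q U2 \<in> line_bundle s q"
    unfolding line_bundle_reps
    by (rule CollectI, rule exI[of _ 1], rule exI[of _ 0], simp,
        rule CollectI, rule exI[of _ 0], rule exI[of _ 1], simp)
  {
    fix Z assume "Z \<in> {pr2 q (A * \<iota>2 U1 + B * \<iota>2 U2) | A B. A \<in> Om_rep s q \<and> B \<in> Om_rep s q}"
    then obtain A B where Z: "Z = pr2 q (A * \<iota>2 U1 + B * \<iota>2 U2)" and AB: "A \<in> Om_rep s q" "B \<in> Om_rep s q"
      by blast
    define r where "r i = (if i = 0 then pr2 q A else pr2 q B)" for i :: nat
    define u where "u i = (if i = 0 then pr q U1 else pr q U2)" for i :: nat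
    have "(\<Oplus>\<^bsub>PP q\<^esub>i\<in>{..<2::nat}. ract q (r i) (u i)) =
        (\<Oplus>\<^bsub>PP q\<^esub>i\<in>{..<2::nat}. pr2 q (if i = 0 then A * \<iota>2 U1 else B * \<iota>2 U2))"
      by (rule finsum_cong') (auto simp: r_def u_def ract_pr carrier_PP)
    also have "\<dots> = Z"
      unfolding Z by (subst pr2_finsum) (simp_all add: numeral_2_eq_2)
    finally have "Z = (\<Oplus>\<^bsub>PP q\<^esub>i\<in>{..<2::nat}. ract q (r i) (u i))" by (rule sym)
    moreover have "r \<in> {..<2} \<rightarrow> Omega1 q (S2 s q)" "u \<in> {..<2} \<rightarrow> line_bundle s q"
      using AB U by (simp_all add: r_def u_def Om_rep_def)
    ultimately show "Z \<in> form_line_bundle s q"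
      unfolding form_line_bundle_def
      by (intro CollectI exI[of _ 2] exI[of _ r] exI[of _ u] conjI)
  }
  fix Z assume "Z \<in> form_line_bundle s q"
  then obtain n :: nat and r u where ru: "r \<in> {..<n} \<rightarrow> Omega1 q (S2 s q)" "u \<in> {..<n} \<rightarrow> line_bundle s q"
    and Z: "Z = (\<Oplus>\<^bsub>PP q\<^esub>i\<in>{..<n}. ract q (r i) (u i))"
    unfolding form_line_bundle_def mem_Collect_eq by (elim exE conjE) (rule that)
  have "\<exists>T. T \<in> Om_rep s q \<and> r i = pr2 q T" if "i < n" for i
  proof -
    have "r i \<in> pr2 q ` Om_rep s q" using ru(1) that unfolding Omega1_S2_reps by (simp add: Pi_iff)
    then show ?thesis by blast
  qed
  then obtain T where T: "\<And>i. i < n \<Longrightarrow> T i \<in> Om_rep s q \<and> r i = pr2 q (T i)" by metis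
  have "\<exists>x y. (x \<in> S2_rep s q \<and> y \<in> S2_rep s q) \<and> u i = pr q (x * U1 + y * U2)" if "i < n" for i
  proof -
    have "u i \<in> line_bundle s q" using ru(2) that by (simp add: Pi_iff)
    then show ?thesis unfolding line_bundle_reps by blast
  qed
  then obtain x y where xy: "\<And>i. i < n \<Longrightarrow> (x i \<in> S2_rep s q \<and> y i \<in> S2_rep s q) \<and> u i = pr q (x i * U1 + y i * U2)"
    by metis
  have "Z = (\<Oplus>\<^bsub>PP q\<^esub>i\<in>{..<n}. pr2 q (T i * \<iota>2 (x i) * \<iota>2 U1 + T i * \<iota>2 (y i) * \<iota>2 U2))"
    unfolding Z
  proof (rule finsum_cong')
    fix i assume "i \<in> {..<n}"
    then show "ract q (r i) (u i) = pr2 q (T i * \<iota>2 (x i) * \<iota>2 U1 + T i * \<iota>2 (y i) * \<iota>2 U2)"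
      using T[of i] xy[of i] by (simp add: ract_pr fa_tensor_add_right \<iota>2_mult distrib_left mult.assoc)
  qed (auto simp: carrier_PP)
  also have "\<dots> = pr2 q ((\<Sum>i<n. T i * \<iota>2 (x i)) * \<iota>2 U1 + (\<Sum>i<n. T i * \<iota>2 (y i)) * \<iota>2 U2)"
    by (simp add: pr2_finsum sum.distrib sum_distrib_right)
  finally have "Z = \<dots>" .
  moreover have "(\<Sum>i<n. T i * \<iota>2 (x i)) \<in> Om_rep s q" "(\<Sum>i<n. T i * \<iota>2 (y i)) \<in> Om_rep s q"
    using T xy by (intro Om_rep_sum Om_rep_right; simp)+
  ultimately show "Z \<in> {pr2 q (A * \<iota>2 U1 + B * \<iota>2 U2) | A B. A \<in> Om_rep s q \<and> B \<in> Om_rep s q}"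
    by blast
qed

lemma id_Theta_bij: "bij_betw (id_Theta s q) (form_proj_module s q) (form_line_bundle s q)"
  unfolding bij_betw_def
proof
  show "inj_on (id_Theta s q) (form_proj_module s q)"
  proof (rule inj_onI)
    fix v w assume "v \<in> form_proj_module s q" "w \<in> form_proj_module s q" and eq: "id_Theta s q v = id_Theta s q w"
    then obtain A B A' B' where vw: "v = form_coords (A * \<iota>2 U1 + B * \<iota>2 U2)" "w = form_coords (A' * \<iota>2 U1 + B' * \<iota>2 U2)"
      "A \<in> Om_rep s q" "B \<in> Om_rep s q" "A' \<in> Om_rep s q" "B' \<in> Om_rep s q"
      unfolding form_proj_module_reps by blast
    then show "v = w" using eq by (simp add: id_Theta_coords form_coords_eq_iff)
  qed
  show "id_Theta s q ` form_proj_module s q = form_line_bundle s q"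
  proof (intro equalityI subsetI)
    fix Z assume "Z \<in> id_Theta s q ` form_proj_module s q"
    then obtain A B where AB: "Z = id_Theta s q (form_coords (A * \<iota>2 U1 + B * \<iota>2 U2))" "A \<in> Om_rep s q" "B \<in> Om_rep s q"
      unfolding form_proj_module_reps by blast
    then have "Z = pr2 q (A * \<iota>2 U1 + B * \<iota>2 U2)" by (simp add: id_Theta_coords)
    with AB show "Z \<in> form_line_bundle s q" unfolding form_line_bundle_reps by blast
  next
    fix Z assume "Z \<in> form_line_bundle s q"
    then obtain A B where "Z = pr2 q (A * \<iota>2 U1 + B * \<iota>2 U2)" "A \<in> Om_rep s q" "B \<in> Om_rep s q"
      unfolding form_line_bundle_reps by blast
    then have "Z = id_Theta s q (form_coords (A * \<iota>2 U1 + B * \<iota>2 U2))"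
      "form_coords (A * \<iota>2 U1 + B * \<iota>2 U2) \<in> form_proj_module s q"
      unfolding form_proj_module_reps by (simp add: id_Theta_coords, blast)
    then show "Z \<in> id_Theta s q ` form_proj_module s q" by blast
  qed
qed

end

section \<open>The covariant derivative\<close>

lemma Omega1_carrier: "A \<subseteq> carrier (SUq2 q) \<Longrightarrow> Omega1 q A \<subseteq> carrier (PP q)"
  unfolding Omega1_reps carrier_PP by blast

lemma \<pi>_in_Cs: "\<pi> s q (pr q f) \<in> Cs s q"
  unfolding Cs_def \<pi>_def A_RCOSETS_def RCOSETS_def a_r_coset_def carrier_SUq2 by auto

locale monopole = hopf_params +
  fixes \<omega> :: "'a fa set set \<Rightarrow> 'a fa2 set"
  assumes \<omega>: "dirac_monopole s q \<omega>"
begin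

text \<open>
  A linear map on the free algebra that represents \<open>\<omega> \<circ> \<pi>\<close>. Representatives are chosen on words
  only, which makes the map exactly linear and not merely linear up to relations.
\<close>

definition W :: "'a fa \<Rightarrow> 'a fa2" where
  "W = lin (\<lambda>w. SOME T. \<omega> (\<pi> s q (pr q (Poly_Mapping.single w 1))) = pr2 q T)"

lemma \<omega>_W: "\<omega> (\<pi> s q (pr q f)) = pr2 q (W f)"
proof (induction f rule: poly_mapping_additive_induct)
  case (single w a)
  have "\<omega> (\<pi> s q (pr q (Poly_Mapping.single w 1))) \<in> carrier (PP q)"
    using \<omega> \<pi>_in_Cs[of s q "Poly_Mapping.single w 1"] Omega1_carrier[of "carrier (SUq2 q)" q]
    unfolding dirac_monopole_def by blast
  then have "\<exists>T. \<omega> (\<pi> s q (pr q (Poly_Mapping.single w 1))) = pr2 q T"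
    unfolding carrier_PP by blast
  from someI_ex[OF this] have 1: "\<omega> (\<pi> s q (pr q (Poly_Mapping.single w 1))) = pr2 q (W (Poly_Mapping.single w 1))"
    by (simp add: W_def lin_single)
  have "\<forall>a. \<forall>x\<in>carrier (SUq2 q). \<omega> (\<pi> s q (pr q (sc a) \<otimes>\<^bsub>SUq2 q\<^esub> x)) = pr2 q (sc a) \<otimes>\<^bsub>PP q\<^esub> \<omega> (\<pi> s q x)"
    using \<omega> unfolding dirac_monopole_def by blast
  then have "\<omega> (\<pi> s q (pr q (sc a) \<otimes>\<^bsub>SUq2 q\<^esub> pr q (Poly_Mapping.single w 1))) = pr2 q (sc a) \<otimes>\<^bsub>PP q\<^esub> pr2 q (W (Poly_Mapping.single w 1))"
    unfolding 1[symmetric] carrier_SUq2 by blast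
  then show ?case by (simp add: sc_times_single W_def lin_single)
next
  case (add f g)
  have "\<forall>x\<in>carrier (SUq2 q). \<forall>y\<in>carrier (SUq2 q).
      \<omega> (\<pi> s q (x \<oplus>\<^bsub>SUq2 q\<^esub> y)) = \<omega> (\<pi> s q x) \<oplus>\<^bsub>PP q\<^esub> \<omega> (\<pi> s q y)"
    using \<omega> unfolding dirac_monopole_def by blast
  then have "\<omega> (\<pi> s q (pr q f \<oplus>\<^bsub>SUq2 q\<^esub> pr q g)) = \<omega> (\<pi> s q (pr q f)) \<oplus>\<^bsub>PP q\<^esub> \<omega> (\<pi> s q (pr q g))"
    unfolding carrier_SUq2 by blast
  then show ?case by (simp add: add W_def lin_add)
qed

lemma W_Js_rep: "g \<in> Js_rep s q \<Longrightarrow> W g \<in> rel_ideal2 q"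
proof -
  assume "g \<in> Js_rep s q"
  then have "\<omega> (\<pi> s q (pr q g)) = \<omega> (\<pi> s q (pr q 0))" by (subst \<pi>_cong[of g 0]) simp_all
  then show ?thesis unfolding \<omega>_W by (simp add: pr2_eq_iff W_def)
qed

lemma bilinear_W: "bilinear_fa (\<lambda>f g. \<iota>1 f * W g)"
  by (simp add: bilinear_fa_def W_def lin_add lin_scale fa_tensor_add_left fa_tensor_scale_left
      distrib_left distrib_right mult.assoc sc_left_commute)

text \<open>
  Since \<open>\<omega> \<circ> \<pi>\<close> vanishes on J, the Sweedler sum in the covariant derivative only depends on the
  coaction, that is on the coproduct modulo P \<open>\<otimes>\<close> J.
\<close>

lemma bil_W_PJ_rep:
  assumes "T \<in> PJ_rep s q"
  shows "bil (\<lambda>f g. \<iota>1 f * W g) T \<in> rel_ideal2 q"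
proof -
  let ?B = "\<lambda>f g. \<iota>1 f * W g"
  have b: "lact q (pr q f) (\<omega> (\<pi> s q (pr q g))) = pr2 q (\<iota>1 f * W g)" for f g
    by (simp add: \<omega>_W lact_pr)
  obtain S where S: "S \<in> sums_of {fa_tensor f g | f g. g \<in> Js_rep s q}" "T - S \<in> rel_ideal2 q"
    using assms unfolding PJ_rep_iff by blast
  have "bil ?B S \<in> rel_ideal2 q"
    using S(1)
  proof (induction rule: sums_of_induct)
    case (add S x)
    then obtain f g where "x = fa_tensor f g" "g \<in> Js_rep s q" by blast
    then have "bil ?B x \<in> rel_ideal2 q"
      by (simp add: bil_tensor[OF bilinear_W] W_Js_rep PP.I_left)
    with add show ?case by (simp add: bil_add PP.I_add)
  qed (simp add: PP.I_zero)
  moreover have "bil ?B (T - S) \<in> rel_ideal2 q"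
    by (rule bil_rel_ideal2[where b = "\<lambda>a b. lact q a (\<omega> (\<pi> s q b))", OF b bilinear_W S(2)])
  ultimately have "bil ?B (T - S) + bil ?B S \<in> rel_ideal2 q" by (intro PP.I_add)
  then show ?thesis by (simp add: bil_diff)
qed

lemma bilinear_Sd: "bilinear_fa (\<lambda>f g. \<iota>1 (fa_antipode q f) * (\<iota>2 g - \<iota>1 g))"
  by (simp add: bilinear_fa_def fa_antipode_lin lin_add lin_scale fa_tensor_linear algebra_simps
      sc_left_commute[of "fa_tensor f g" for f g])

lemma \<omega>_g1: "pr2 q (W U1) = pr2 q (sc c * (\<iota>1 V1 * \<iota>2 U1 + \<iota>1 V2 * \<iota>2 U2) - 1)"
proof -
  let ?B = "\<lambda>f g. \<iota>1 (fa_antipode q f) * (\<iota>2 g - \<iota>1 g)"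
  have b: "lact q (antipode q (pr q f)) (univ_d q (pr q g)) = pr2 q (?B f g)" for f g
    by (simp add: antipode_pr[OF q] univ_d_pr lact_pr)
  have ip: "iplus s q 1 = pr q (sc c * (U1 + sc s * U2))"
    by (simp add: iplus_def c_def u\<^sub>1_def u\<^sub>2_def algebra_simps sc_sc_left power2_eq_square)
  have cop: "fa_coprod (sc c * (U1 + sc s * U2)) =
      sc c * (fa_tensor (\<alpha> + sc s * \<gamma>) U1 + fa_tensor (\<beta> + sc s * \<delta>) U2)"
    by (simp add: fa_coprod_mult fa_coprod_add uv_coprod[OF q] fa_tensor_add_left fa_tensor_scale_left
       fa_tensor_mult algebra_simps)
  have S: "fa_antipode q (\<alpha> + sc s * \<gamma>) = V1" "fa_antipode q (\<beta> + sc s * \<delta>) = V2"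
    by (simp_all add: fa_antipode_add fa_antipode_mult v\<^sub>1_def v\<^sub>2_def fa_norm algebra_simps)
  have "pr2 q (W U1) = \<omega> (gplus s q 1)"
    by (simp only: gplus_1 \<omega>_W)
  also have "\<dots> = sweedler q (\<lambda>a b. lact q (antipode q a) (univ_d q b)) (iplus s q 1)"
    using \<omega> unfolding dirac_monopole_def by blast
  also have "\<dots> = pr2 q (bil ?B (fa_coprod (sc c * (U1 + sc s * U2))))"
    unfolding ip by (rule sweedler_eq[OF b bilinear_Sd q])
  also have "bil ?B (fa_coprod (sc c * (U1 + sc s * U2))) =
      sc c * (\<iota>1 V1 * (\<iota>2 U1 - \<iota>1 U1) + \<iota>1 V2 * (\<iota>2 U2 - \<iota>1 U2))"
    unfolding cop bil_scale bil_add bil_tensor[OF bilinear_Sd] S by (rule refl)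
  also have "\<dots> = (sc c * (\<iota>1 V1 * \<iota>2 U1 + \<iota>1 V2 * \<iota>2 U2) - 1) - \<iota>1 (sc c * 1 * V1 * U1 + sc c * 1 * V2 * U2 - 1)"
    by (simp add: fa_tensor_diff_left fa_tensor_add_left fa_tensor_scale_left \<iota>1_mult algebra_simps)
  also have "pr2 q \<dots> = pr2 q (sc c * (\<iota>1 V1 * \<iota>2 U1 + \<iota>1 V2 * \<iota>2 U2) - 1)"
    using \<iota>1_rel_ideal[OF vu_unit[of 1]] by (simp add: pr2_eq_iff PP.I_minus)
  finally show ?thesis .
qed

text \<open>
  The summand \<open>- 1 \<otimes> 1\<close> of \<open>\<omega>(g\<^sub>1\<^sup>+)\<close> contributes \<open>p \<otimes> 1\<close>, which cancels against
  \<open>dp = 1 \<otimes> p - p \<otimes> 1\<close>.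
\<close>

lemma nabla_line:
  assumes "fa_coprod p - fa_tensor p U1 \<in> PJ_rep s q"
  shows "nabla s q \<omega> (pr q p) = pr2 q (\<iota>2 p - (\<iota>1 (sc c * p * V1) * \<iota>2 U1 + \<iota>1 (sc c * p * V2) * \<iota>2 U2))"
proof -
  let ?B = "\<lambda>f g. \<iota>1 f * W g"
  have b: "lact q (pr q f) (\<omega> (\<pi> s q (pr q g))) = pr2 q (\<iota>1 f * W g)" for f g
    by (simp add: \<omega>_W lact_pr)
  have "sweedler q (\<lambda>a b. lact q a (\<omega> (\<pi> s q b))) (pr q p) = pr2 q (bil ?B (fa_coprod p))"
    by (rule sweedler_eq[OF b bilinear_W q])
  also have "\<dots> = pr2 q (\<iota>1 p * W U1)"
    using bil_W_PJ_rep[OF assms] by (simp add: pr2_eq_iff bil_diff bil_tensor[OF bilinear_W])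
  also have "\<dots> = pr2 q (\<iota>1 p) \<otimes>\<^bsub>PP q\<^esub> pr2 q (W U1)" by simp
  also have "\<dots> = pr2 q (\<iota>1 p * (sc c * (\<iota>1 V1 * \<iota>2 U1 + \<iota>1 V2 * \<iota>2 U2) - 1))"
    unfolding \<omega>_g1 by simp
  finally have *: "sweedler q (\<lambda>a b. lact q a (\<omega> (\<pi> s q b))) (pr q p) = \<dots>" .
  have "\<iota>2 p - \<iota>1 p - \<iota>1 p * (sc c * (\<iota>1 V1 * \<iota>2 U1 + \<iota>1 V2 * \<iota>2 U2) - 1) =
      \<iota>2 p - (\<iota>1 (sc c * p * V1) * \<iota>2 U1 + \<iota>1 (sc c * p * V2) * \<iota>2 U2)"
    by (simp add: \<iota>1_mult fa_tensor_scale_left algebra_simps sc_left_commute[of "fa_tensor f g" for f g])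
  then show ?thesis unfolding nabla_def * univ_d_pr pr2_minus by (rule arg_cong[where f = "pr2 q"])
qed

text \<open>
  The components of the row d(x, y) + (x, y) de of one-forms.
\<close>

definition gr\<^sub>1 :: "'a fa \<Rightarrow> 'a fa \<Rightarrow> 'a fa2" where
  "gr\<^sub>1 x y = (\<iota>2 x - \<iota>1 x) + (\<iota>1 x * (\<iota>2 E11 - \<iota>1 E11) + \<iota>1 y * (\<iota>2 E21 - \<iota>1 E21))"

definition gr\<^sub>2 :: "'a fa \<Rightarrow> 'a fa \<Rightarrow> 'a fa2" where
  "gr\<^sub>2 x y = (\<iota>2 y - \<iota>1 y) + (\<iota>1 x * (\<iota>2 E12 - \<iota>1 E12) + \<iota>1 y * (\<iota>2 E22 - \<iota>1 E22))"

lemma grassmann_pr: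
  "row_add (PP q) (row_map (univ_d q) (pr q x, pr q y))
     (row_form_mult q (pr q x, pr q y) (mat_map (univ_d q) (projector s q))) = (pr2 q (gr\<^sub>1 x y), pr2 q (gr\<^sub>2 x y))"
  by (simp add: row_add_def row_form_mult_def row_mult_def projector_pr univ_d_pr tensor_pr gr\<^sub>1_def gr\<^sub>2_def)

lemma gr_Om_rep:
  assumes "x \<in> S2_rep s q" "y \<in> S2_rep s q"
  shows "gr\<^sub>1 x y \<in> Om_rep s q" "gr\<^sub>2 x y \<in> Om_rep s q"
  unfolding gr\<^sub>1_def gr\<^sub>2_def by (simp_all add: Om_rep_add Om_rep_left Om_rep_d assms E_S2_rep)

lemma nabla_grassmann:
  assumes "x \<in> S2_rep s q" "y \<in> S2_rep s q"
  shows "nabla s q \<omega> (pr q (x * U1 + y * U2)) = pr2 q (gr\<^sub>1 x y * \<iota>2 U1 + gr\<^sub>2 x y * \<iota>2 U2)"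
proof -
  let ?p = "x * U1 + y * U2"
  have "gr\<^sub>1 x y * \<iota>2 U1 + gr\<^sub>2 x y * \<iota>2 U2 -
      (\<iota>2 ?p - (\<iota>1 (sc c * ?p * V1) * \<iota>2 U1 + \<iota>1 (sc c * ?p * V2) * \<iota>2 U2)) =
    \<iota>1 x * \<iota>2 (E11 * U1 + E12 * U2 - U1) + \<iota>1 y * \<iota>2 (E21 * U1 + E22 * U2 - U2) +
    \<iota>1 (sc c * ?p * V1 - (x * E11 + y * E21)) * \<iota>2 U1 + \<iota>1 (sc c * ?p * V2 - (x * E12 + y * E22)) * \<iota>2 U2"
    unfolding fa_tensor_diff_left[of "sc c * ?p * V1"] fa_tensor_diff_left[of "sc c * ?p * V2"]
    by (simp add: gr\<^sub>1_def gr\<^sub>2_def \<iota>1_mult[of x] \<iota>1_mult[of y] \<iota>2_mult fa_tensor_add_right fa_tensor_diff_right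
       fa_tensor_add_left[of "x * E11"] fa_tensor_add_left[of "x * E12"] algebra_simps)
  also have "\<dots> \<in> rel_ideal2 q"
    by (intro PP.I_add PP.I_left PP.I_right \<iota>1_rel_ideal \<iota>2_rel_ideal E_U row_E)
  finally show ?thesis
    unfolding nabla_line[OF coprod_line[OF assms]] by (intro sym[of "pr2 q (gr\<^sub>1 x y * _ + _)"]) (simp only: pr2_eq_iff)
qed

lemma nabla_form_line_bundle: "nabla s q \<omega> \<in> line_bundle s q \<rightarrow> form_line_bundle s q"
proof (rule Pi_I)
  fix A assume "A \<in> line_bundle s q"
  then obtain x y where xy: "A = pr q (x * U1 + y * U2)" "x \<in> S2_rep s q" "y \<in> S2_rep s q"
    unfolding line_bundle_reps by blast
  then have "nabla s q \<omega> A = pr2 q (gr\<^sub>1 x y * \<iota>2 U1 + gr\<^sub>2 x y * \<iota>2 U2)"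
    by (simp only: nabla_grassmann)
  with gr_Om_rep[OF xy(2,3)] show "nabla s q \<omega> A \<in> form_line_bundle s q"
    unfolding form_line_bundle_reps by blast
qed

lemma nabla_viewed_grassmann:
  assumes xy: "x \<in> S2_rep s q" "y \<in> S2_rep s q"
  shows "nabla_viewed s q \<omega> (row_mult (SUq2 q) (pr q x, pr q y) (projector s q)) =
    form_row_mult q (row_add (PP q) (row_map (univ_d q) (pr q x, pr q y))
      (row_form_mult q (pr q x, pr q y) (mat_map (univ_d q) (projector s q)))) (projector s q)"
proof -
  let ?T = "gr\<^sub>1 x y * \<iota>2 U1 + gr\<^sub>2 x y * \<iota>2 U2"
  have "nabla_viewed s q \<omega> (row_mult (SUq2 q) (pr q x, pr q y) (projector s q)) =
      inv_into (form_proj_module s q) (id_Theta s q) (pr2 q ?T)"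
    by (simp only: nabla_viewed_def o_apply row_mult_projector Theta_coords[OF xy] nabla_grassmann[OF xy])
  also have "pr2 q ?T = id_Theta s q (form_coords ?T)"
    by (rule id_Theta_coords[OF gr_Om_rep[OF xy], symmetric])
  also have "inv_into (form_proj_module s q) (id_Theta s q) (id_Theta s q (form_coords ?T)) = form_coords ?T"
  proof (rule inv_into_f_f)
    show "inj_on (id_Theta s q) (form_proj_module s q)"
      using id_Theta_bij by (rule bij_betw_imp_inj_on)
    show "form_coords ?T \<in> form_proj_module s q"
      unfolding form_proj_module_reps using gr_Om_rep[OF xy] by blast
  qed
  finally show ?thesis unfolding grassmann_pr form_row_mult_projector .
qed

end

theorem mainTheorem3:
  fixes s q :: "'k::real_normed_field"
    and \<omega> :: "'k fa set set \<Rightarrow> 'k fa2 set"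
  assumes s: "s \<in> of_real ` {0..1}"
    and q: "q \<noteq> 0"
    and \<omega>: "dirac_monopole s q \<omega>"
  shows "line_bundle s q \<subseteq> associated_module s q (gplus s q 1)
       \<and> (coinvariants s q = S2 s q \<longrightarrow> line_bundle s q = associated_module s q (gplus s q 1))
       \<and> bij_betw (Theta s q) (proj_module s q) (line_bundle s q)
       \<and> bij_betw (id_Theta s q) (form_proj_module s q) (form_line_bundle s q)
       \<and> nabla s q \<omega> \<in> line_bundle s q \<rightarrow> form_line_bundle s q
       \<and> (\<forall>x\<in>S2 s q. \<forall>y\<in>S2 s q.
            nabla_viewed s q \<omega> (row_mult (SUq2 q) (x, y) (projector s q)) =
            form_row_mult q
              (row_add (PP q)
                (row_map (univ_d q) (x, y))
                (row_form_mult q (x, y) (mat_map (univ_d q) (projector s q))))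
              (projector s q))"
proof -
  have "\<forall>m::nat. 1 + q ^ (2 * m) * s^2 \<noteq> 0" using \<omega> unfolding dirac_monopole_def by blast
  from spec[OF this, of 0] have "1 + s^2 \<noteq> 0" by simp
  then interpret monopole s q \<omega> using q \<omega> by unfold_locales
  show ?thesis
  proof (intro conjI impI ballI)
    show "line_bundle s q = associated_module s q (gplus s q 1)" if "coinvariants s q = S2 s q"
      using line_bundle_associated associated_line_bundle[OF that] by (rule equalityI)
    fix x y assume "x \<in> S2 s q" "y \<in> S2 s q"
    then obtain f g where fg: "x = pr q f" "f \<in> S2_rep s q" "y = pr q g" "g \<in> S2_rep s q"
      unfolding S2_reps by blast
    show "nabla_viewed s q \<omega> (row_mult (SUq2 q) (x, y) (projector s q)) =
        form_row_mult q (row_add (PP q) (row_map (univ_d q) (x, y))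
          (row_form_mult q (x, y) (mat_map (univ_d q) (projector s q)))) (projector s q)"
      unfolding fg by (rule nabla_viewed_grassmann[OF fg(2,4)])
  qed (rule line_bundle_associated Theta_bij id_Theta_bij nabla_form_line_bundle)+
qed

end
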